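(* Let $\mathbf P$ be an irreducible $s\times s$ stochastic matrix, and let $\mathbf B\in\mathbb R^{r\times s}$ and $\mathbf C\in\mathbb R^{s\times r}$ be fixed matrices. Suppose that $\rho(\mathbf B\mathbf P\mathbf C)<1$, where $\rho$ is the spectral radius, and define $$\mathbf N_{\mathbf B,\mathbf C}(\mathbf P)=(\mathbf I_r-\mathbf B\mathbf P\mathbf C)^{-1}.$$ Then the map $\mathbf N_{\mathbf B,\mathbf C}$ has Fréchet derivative at $\mathbf P$ $$\mathbf N'_{\mathbf B,\mathbf C;\mathbf P}(\mathbf H)=\mathbf N_{\mathbf B,\mathbf C}(\mathbf P)\,\mathbf B\mathbf H\mathbf C\,\mathbf N_{\mathbf B,\mathbf C}(\mathbf P),$$ and, with $\widehat{\mathbf P}(n)$ the maximum likelihood estimator of $\mathbf P$ and $\mathbf W$ the Gaussian matrix of the context, $$\sqrt n\{\mathbf N_{\mathbf B,\mathbf C}(\widehat{\mathbf P}(n))-\mathbf N_{\mathbf B,\mathbf C}(\mathbf P)\}\xrightarrow{d}\mathbf N_{\mathbf B,\mathbf C}(\mathbf P)\,\mathbf B\mathbf W\mathbf C\,\mathbf N_{\mathbf B,\mathbf C}(\mathbf P).$$ For fixed $\mathbf u\in\mathbb R^{1\times r}$ and $\mathbf v\in\mathbb R^{r\times1}$, the functional $\phi(\mathbf P)=\mathbf u\mathbf N_{\mathbf B,\mathbf C}(\mathbf P)\mathbf v$ satisfies $$\sqrt n\{\phi(\widehat{\mathbf P}(n))-\phi(\mathbf P)\}\xrightarrow{d}\mathbf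 u\mathbf N_{\mathbf B,\mathbf C}(\mathbf P)\,\mathbf B\mathbf W\mathbf C\,\mathbf N_{\mathbf B,\mathbf C}(\mathbf P)\mathbf v.$$
   Context: $(X_m)_{m\ge0}$ is a time-homogeneous Markov chain on $\{1,\ldots,s\}$ with irreducible transition matrix $\mathbf P=(p_{ij})$ and stationary row vector $\boldsymbol\pi=(\pi_1,\ldots,\pi_s)$, observed along a single trajectory $X_0,\ldots,X_n$. $N_{ij}(n)$ is the number of transitions from $i$ to $j$ up to time $n$, $N_i(n)=\sum_jN_{ij}(n)$, and $\widehat{\mathbf P}(n)$ has entries $N_{ij}(n)/N_i(n)$ (and $0$ if $N_i(n)=0$). Limits are as $n\to\infty$; $\xrightarrow{d}$ is convergence in distribution. Plug-in quantities may be defined arbitrarily when the defining inverse does not exist at $\widehat{\mathbf P}(n)$. $\mathbf W=(W_{ij})$ is the centered Gaussian random $s\times s$ matrix with $\operatorname{Cov}(W_{ij},W_{kl})=\delta_{ik}\pi_i^{-1}p_{ij}(\delta_{jl}-p_{il})$. *)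

theory Defs
  imports "HOL-Probability.Probability"
begin

section \<open>Matrices\<close>

definition stochastic_matrix :: "real^'s^'s \<Rightarrow> bool" where
  "stochastic_matrix P \<longleftrightarrow> (\<forall>i j. 0 \<le> P $ i $ j) \<and> (\<forall>i. (\<Sum>j\<in>UNIV. P $ i $ j) = 1)"

definition matrix_power :: "real^'s^'s \<Rightarrow> nat \<Rightarrow> real^'s^'s" where
  "matrix_power A k = ((**) A ^^ k) (mat 1)"

definition irreducible_matrix :: "real^'s^'s \<Rightarrow> bool" where
  "irreducible_matrix P \<longleftrightarrow> (\<forall>i j. \<exists>k. 0 < matrix_power P k $ i $ j)"

definition stationary_vector :: "real^'s^'s \<Rightarrow> real^'s \<Rightarrow> bool" where
  "stationary_vector P p \<longleftrightarrow>
     (\<forall>i. 0 \<le> p $ i) \<and> (\<Sum>i\<in>UNIV. p $ i) = 1 \<and> p v* P = p"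

definition complex_spectrum :: "real^'r^'r \<Rightarrow> complex set" where
  "complex_spectrum A = {l. \<exists>v. v \<noteq> 0 \<and> map_matrix of_real A *v v = l *s v}"

text \<open>The spectrum is finite and non-empty, so the supremum is a maximum.\<close>
definition spectral_radius :: "real^'r^'r \<Rightarrow> real" where
  "spectral_radius A = (SUP l\<in>complex_spectrum A. cmod l)"


section \<open>Markov chains and empirical transition matrices\<close>

text \<open>The initial distribution is arbitrary.\<close>
definition markov_chain :: "'a measure \<Rightarrow> (nat \<Rightarrow> 'a \<Rightarrow> 's) \<Rightarrow> real^'s^'s \<Rightarrow> bool" where
  "markov_chain M X P \<longleftrightarrow>
     prob_space M \<and>
     (\<forall>n. X n \<in> measurable M (count_space UNIV)) \<and>
     (\<forall>n x j. \<P>(\<omega> in M. \<forall>m\<le>n. X m \<omega> = x m) > 0 \<longrightarrow>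
        \<P>(\<omega> in M. X (Suc n) \<omega> = j \<bar> \<forall>m\<le>n. X m \<omega> = x m) = P $ x n $ j)"

definition transition_count :: "(nat \<Rightarrow> 'a \<Rightarrow> 's) \<Rightarrow> nat \<Rightarrow> 's \<Rightarrow> 's \<Rightarrow> 'a \<Rightarrow> nat" where
  "transition_count X n i j \<omega> = card {m. m < n \<and> X m \<omega> = i \<and> X (Suc m) \<omega> = j}"

definition visit_count :: "(nat \<Rightarrow> 'a \<Rightarrow> 's::finite) \<Rightarrow> nat \<Rightarrow> 's \<Rightarrow> 'a \<Rightarrow> nat" where
  "visit_count X n i \<omega> = (\<Sum>j\<in>UNIV. transition_count X n i j \<omega>)"

definition transition_mle :: "(nat \<Rightarrow> 'a \<Rightarrow> 's::finite) \<Rightarrow> nat \<Rightarrow> 'a \<Rightarrow> real^'s^'s" where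
  "transition_mle X n \<omega> =
     (\<chi> i j. if visit_count X n i \<omega> = 0 then 0
             else real (transition_count X n i j \<omega>) / real (visit_count X n i \<omega>))"


section \<open>Gaussian random matrices\<close>

text \<open>Standard deviation 0 is allowed and gives a point mass: the limit law below is always
  degenerate, since its rows sum to zero.\<close>
definition gaussian_rv :: "'b measure \<Rightarrow> ('b \<Rightarrow> real) \<Rightarrow> bool" where
  "gaussian_rv M Y \<longleftrightarrow> Y \<in> borel_measurable M \<and>
     (\<exists>\<mu> \<sigma>. 0 \<le> \<sigma> \<and>
        distr M borel Y = (if \<sigma> = 0 then return borel \<mu> else density lborel (normal_density \<mu> \<sigma>)))"

definition gaussian_matrix :: "'b measure \<Rightarrow> ('b \<Rightarrow> real^'n^'m) \<Rightarrow> bool" where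
  "gaussian_matrix M W \<longleftrightarrow> prob_space M \<and> W \<in> borel_measurable M \<and>
     (\<forall>a. gaussian_rv M (\<lambda>\<omega>. \<Sum>i\<in>UNIV. \<Sum>j\<in>UNIV. a i j * W \<omega> $ i $ j))"

definition covariance :: "'b measure \<Rightarrow> ('b \<Rightarrow> real) \<Rightarrow> ('b \<Rightarrow> real) \<Rightarrow> real" where
  "covariance M Y Z =
     (\<integral>\<omega>. (Y \<omega> - (\<integral>\<omega>. Y \<omega> \<partial>M)) * (Z \<omega> - (\<integral>\<omega>. Z \<omega> \<partial>M)) \<partial>M)"

definition mle_limit_matrix ::
    "'b measure \<Rightarrow> ('b \<Rightarrow> real^'s^'s) \<Rightarrow> real^'s^'s \<Rightarrow> real^'s \<Rightarrow> bool" where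
  "mle_limit_matrix M W P p \<longleftrightarrow>
     gaussian_matrix M W \<and>
     (\<forall>i j. (\<integral>\<omega>. W \<omega> $ i $ j \<partial>M) = 0) \<and>
     (\<forall>i j k l. covariance M (\<lambda>\<omega>. W \<omega> $ i $ j) (\<lambda>\<omega>. W \<omega> $ k $ l) =
        of_bool (i = k) * inverse (p $ i) * P $ i $ j * (of_bool (j = l) - P $ i $ l))"


section \<open>Convergence in distribution\<close>

text \<open>The limit variable may live on a probability space of its own.\<close>
definition converges_in_distribution ::
    "'a measure \<Rightarrow> (nat \<Rightarrow> 'a \<Rightarrow> 'c::topological_space) \<Rightarrow> 'b measure \<Rightarrow> ('b \<Rightarrow> 'c) \<Rightarrow> bool" where
  "converges_in_distribution M Y M' Z \<longleftrightarrow>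
     (\<forall>n. Y n \<in> borel_measurable M) \<and> Z \<in> borel_measurable M' \<and>
     (\<forall>f :: 'c \<Rightarrow> real. continuous_on UNIV f \<and> bounded (range f) \<longrightarrow>
        (\<lambda>n. \<integral>\<omega>. f (Y n \<omega>) \<partial>M) \<longlonglongrightarrow> (\<integral>\<omega>. f (Z \<omega>) \<partial>M'))"

lemma converges_in_distribution_real_iff:
  fixes Y :: "nat \<Rightarrow> 'a \<Rightarrow> real" and Z :: "'b \<Rightarrow> real"
  assumes "prob_space M" "prob_space M'"
    and [measurable]: "\<And>n. Y n \<in> borel_measurable M" "Z \<in> borel_measurable M'"
  shows "converges_in_distribution M Y M' Z \<longleftrightarrow>
           weak_conv_m (\<lambda>n. distr M borel (Y n)) (distr M' borel Z)"
    (is "?L \<longleftrightarrow> ?R")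
proof
  have rd: "real_distribution (distr M borel (Y n))" "real_distribution (distr M' borel Z)" for n
    using assms by (auto intro!: prob_space.real_distribution_distr)
  {
    assume L: ?L
    show ?R
    proof (rule integral_bdd_continuous_conv_imp_weak_conv[OF rd])
      fix f :: "real \<Rightarrow> real"
      assume f: "\<And>x. isCont f x" "\<And>x. \<bar>f x\<bar> \<le> 1"
      have c: "continuous_on UNIV f"
        using f(1) by (simp add: continuous_at_imp_continuous_on)
      then have [measurable]: "f \<in> borel_measurable borel"
        by (rule borel_measurable_continuous_onI)
      have "bounded (range f)"
        using f(2) by (auto simp: bounded_iff)
      with L c show "(\<lambda>n. integral\<^sup>L (distr M borel (Y n)) f) \<longlonglongrightarrow> integral\<^sup>L (distr M' borel Z) f"
        by (simp add: converges_in_distribution_def integral_distr)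
    qed
  next
    assume R: ?R
    have "(\<lambda>n. \<integral>\<omega>. f (Y n \<omega>) \<partial>M) \<longlonglongrightarrow> (\<integral>\<omega>. f (Z \<omega>) \<partial>M')"
      if c: "continuous_on UNIV f" and b: "bounded (range f)" for f :: "real \<Rightarrow> real"
    proof -
      have [measurable]: "f \<in> borel_measurable borel"
        using c by (rule borel_measurable_continuous_onI)
      obtain K where "\<And>x. norm (f x) \<le> K"
        using b by (auto simp: bounded_iff)
      then have "(\<lambda>n. integral\<^sup>L (distr M borel (Y n)) f) \<longlonglongrightarrow> integral\<^sup>L (distr M' borel Z) f"
        using c by (intro weak_conv_imp_integral_bdd_continuous_conv[OF rd R])
                   (auto simp: continuous_on_eq_continuous_at)
      then show ?thesis
        by (simp add: integral_distr)
    qed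
    then show ?L
      by (simp add: converges_in_distribution_def)
  }
qed

end

theory Submission
  imports Defs
begin

text \<open>
The estimator is a random matrix $\widehat P(n)$ and the quantities of interest are smooth functions of
it near \<open>P\<close>, so the delta method reduces everything to asymptotic normality of
$\sqrt n(\widehat P(n) - P)$ (\<open>mle_asymptotically_normal\<close>) and to a derivative. The spectral radius
enters only through the fact that 1 is not an eigenvalue of \<open>B ** P ** C\<close>, which makes
\<open>mat 1 - B ** P ** C\<close> invertible (\<open>invertible_if_spectral_radius_less_1\<close>); invertibility is an open
condition, and the derivative of the matrix inverse (\<open>has_derivative_matrix_inv\<close>) with the chain rule
gives $N(P)BHCN(P)$.

Asymptotic normality is a martingale phenomenon. The matrix with entries $N_{ij}(n) - p_{ij}N_i(n)$ is a
sum of increments with conditional mean zero given the past. For such a sum, the characteristic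
function is multiplied in each step by approximately $e^{-v(X_m)/2n}$, where $v(i)$ is the variance of
an increment from state $i$, and the product of these factors is governed by the
average of $v$ along the trajectory (\<open>martingale_clt\<close>). That average converges to its stationary mean
(\<open>ergodic_L1\<close>): the Poisson equation, solvable by the maximum principle for irreducible matrices, writes
a centred sum along the chain as another martingale plus a bounded term. The limiting variance is that
of the Gaussian matrix \<open>W\<close>. Finally the row counts in the denominators are replaced by their limits
$n\pi_i$, again by the ergodic theorem.

To pass from characteristic functions to convergence in distribution of random matrices, a
continuity theorem in several dimensions is needed (\<open>converges_in_distribution_of_char\<close>). It follows
from the one-dimensional theorem, which gives tightness of every coordinate, and from the density of
trigonometric polynomials on balls.
\<close>

section \<open>Trigonometric polynomials\<close>

text \<open>A wave with a free phase stands for both sine and cosine. The product of two waves is a sum of two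
waves, so this class is an algebra, and the expectation of each of its members is a linear
expression in values of the characteristic function.\<close>

inductive trig_polynomial :: "('a::real_inner \<Rightarrow> real) \<Rightarrow> bool" where
  wave: "trig_polynomial (\<lambda>x. c * cos (a \<bullet> x + t))"
| add: "trig_polynomial f \<Longrightarrow> trig_polynomial g \<Longrightarrow> trig_polynomial (\<lambda>x. f x + g x)"

lemma trig_polynomial_const: "trig_polynomial (\<lambda>x. c)"
  using trig_polynomial.wave[of c 0 0] by simp

lemma trig_polynomial_mult:
  assumes "trig_polynomial f" "trig_polynomial g"
  shows "trig_polynomial (\<lambda>x. f x * g x)"
  using assms(1)
proof induction
  case (wave c a t)
  show ?case
    using assms(2)
  proof induction
    case (wave d b s)
    have "(\<lambda>x. c * cos (a \<bullet> x + t) * (d * cos (b \<bullet> x + s))) =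
      (\<lambda>x. c * d / 2 * cos ((a - b) \<bullet> x + (t - s)) + c * d / 2 * cos ((a + b) \<bullet> x + (t + s)))"
    proof
      fix x
      have "cos (a \<bullet> x + t) * cos (b \<bullet> x + s) =
        (cos ((a \<bullet> x + t) - (b \<bullet> x + s)) + cos ((a \<bullet> x + t) + (b \<bullet> x + s))) / 2"
        by (rule cos_times_cos)
      moreover have "(a \<bullet> x + t) - (b \<bullet> x + s) = (a - b) \<bullet> x + (t - s)"
        "(a \<bullet> x + t) + (b \<bullet> x + s) = (a + b) \<bullet> x + (t + s)"
        by (simp_all add: inner_diff_left inner_add_left)
      ultimately show "c * cos (a \<bullet> x + t) * (d * cos (b \<bullet> x + s)) =
        c * d / 2 * cos ((a - b) \<bullet> x + (t - s)) + c * d / 2 * cos ((a + b) \<bullet> x + (t + s))"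
        by (simp add: field_simps)
    qed
    then show ?case
      by (simp only: trig_polynomial.intros)
  next
    case (add g h)
    then show ?case
      by (simp add: distrib_left trig_polynomial.add)
  qed
next
  case (add f h)
  then show ?case
    by (simp add: distrib_right trig_polynomial.add)
qed

lemma continuous_on_trig_polynomial: "trig_polynomial f \<Longrightarrow> continuous_on S f"
  by (induction rule: trig_polynomial.induct) (auto intro!: continuous_intros)

lemma trig_polynomial_bounded: "trig_polynomial f \<Longrightarrow> \<exists>B. \<forall>x. \<bar>f x\<bar> \<le> B"
proof (induction rule: trig_polynomial.induct)
  case (wave c a t)
  have "\<bar>c * cos (a \<bullet> x + t)\<bar> \<le> \<bar>c\<bar>" for x
    by (simp add: abs_mult mult_left_le)
  then show ?case by blast
next
  case (add f g)
  then obtain B C where "\<And>x. \<bar>f x\<bar> \<le> B" "\<And>x. \<bar>g x\<bar> \<le> C" by blast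
  then have "\<bar>f x + g x\<bar> \<le> B + C" for x
    by (meson abs_triangle_ineq add_mono order_trans)
  then show ?case by blast
qed

lemma trig_polynomial_separates:
  assumes "x \<noteq> y"
  shows "\<exists>f. trig_polynomial f \<and> f x \<noteq> f y"
proof -
  define a where "a = (pi / (norm (x - y))\<^sup>2) *\<^sub>R (x - y)"
  \<comment> \<open>The phases of \<open>x\<close> and \<open>y\<close> differ by half a turn, so the sign flips; the shift makes the value
     at \<open>y\<close> equal to 1.\<close>
  have "a \<bullet> (x - y) = pi"
    using assms by (simp add: a_def dot_square_norm)
  then have "a \<bullet> x = a \<bullet> y + pi"
    by (simp add: inner_diff_right)
  then have "1 * cos (a \<bullet> x + - (a \<bullet> y)) \<noteq> 1 * cos (a \<bullet> y + - (a \<bullet> y))"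
    by simp
  then show ?thesis
    using trig_polynomial.wave[of 1 a "- (a \<bullet> y)"] by (intro exI conjI)
qed

lemma trig_polynomial_compose:
  fixes q :: "real \<Rightarrow> real"
  assumes "real_polynomial_function q" "trig_polynomial g"
  shows "trig_polynomial (\<lambda>x. q (g x))"
  using assms(1)
proof induction
  case (linear f)
  then have "f y = f 1 * y" for y
    using linear_scale[OF bounded_linear.linear[OF linear], of y 1] by (simp add: mult.commute)
  then have "(\<lambda>x. f (g x)) = (\<lambda>x. f 1 * g x)"
    by blast
  then show ?case
    using trig_polynomial_mult[OF trig_polynomial_const assms(2)] by simp
qed (auto intro: trig_polynomial_const trig_polynomial.add trig_polynomial_mult)

text \<open>The Stone--Weierstrass theorem gives closeness on a ball only. The bound on the whole space is what
makes the approximation usable under an integral: it controls the error on the event that the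
random vector leaves the ball.\<close>

lemma trig_polynomial_approximation:
  fixes f :: "'a::euclidean_space \<Rightarrow> real"
  assumes f: "continuous_on UNIV f" "\<And>x. \<bar>f x\<bar> \<le> B" and e: "0 < e"
  obtains g where "trig_polynomial g" "\<And>x. norm x \<le> K \<Longrightarrow> \<bar>f x - g x\<bar> \<le> e"
    "\<And>x. \<bar>g x\<bar> \<le> B + e"
proof -
  interpret R: function_ring_on "Collect trig_polynomial" "cball 0 K :: 'a set"
    by unfold_locales
      (auto intro: continuous_on_trig_polynomial trig_polynomial.add trig_polynomial_mult
        trig_polynomial_const dest: trig_polynomial_separates)
  have "continuous_on (cball 0 K) f"
    using f(1) continuous_on_subset by blast
  from R.Stone_Weierstrass_basic[OF this, of "e/2"] e
  obtain g where g: "trig_polynomial g" "\<And>x. norm x \<le> K \<Longrightarrow> \<bar>f x - g x\<bar> < e / 2"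
    by auto
  obtain G where G: "\<And>x. \<bar>g x\<bar> \<le> G"
    using trig_polynomial_bounded[OF g(1)] by blast
  \<comment> \<open>Outside the ball \<open>g\<close> is uncontrolled. Clamp it to the range of \<open>f\<close>, with a polynomial
     in place of the clamp so that the result is again a trigonometric polynomial.\<close>
  define clamp where "clamp y = max (- B) (min B y)" for y :: real
  have "continuous_on {-G..G} clamp"
    unfolding clamp_def by (intro continuous_intros)
  then obtain q where q: "real_polynomial_function q"
    "\<And>y. y \<in> {-G..G} \<Longrightarrow> \<bar>clamp y - q y\<bar> < e / 2"
    using Stone_Weierstrass_real_polynomial_function[OF compact_Icc _ half_gt_zero[OF e]]
    by metis
  have qg: "\<bar>clamp (g x) - q (g x)\<bar> < e / 2" for x
    using G[of x] by (intro q(2)) (simp add: abs_le_iff)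
  show ?thesis
  proof (rule that)
    show "trig_polynomial (\<lambda>x. q (g x))"
      by (rule trig_polynomial_compose[OF q(1) g(1)])
    show "\<bar>f x - q (g x)\<bar> \<le> e" if "norm x \<le> K" for x
      using g(2)[OF that] qg[of x] f(2)[of x] unfolding clamp_def by linarith
    show "\<bar>q (g x)\<bar> \<le> B + e" for x
      using qg[of x] f(2)[of x] e unfolding clamp_def by linarith
  qed
qed

section \<open>Convergence in distribution and tightness\<close>

lemma norm_integral_le:
  fixes f :: "'a \<Rightarrow> 'b::{banach, second_countable_topology}"
  assumes "integrable M f" "integrable M g" "\<And>x. x \<in> space M \<Longrightarrow> norm (f x) \<le> g x"
  shows "norm (\<integral>x. f x \<partial>M) \<le> (\<integral>x. g x \<partial>M)"
  using assms by (intro order_trans[OF integral_norm_bound integral_mono]) auto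

lemma (in prob_space) integrable_bounded_continuous:
  fixes f :: "'b::topological_space \<Rightarrow> real"
  assumes "continuous_on UNIV f" "\<And>x. \<bar>f x\<bar> \<le> B" "Y \<in> borel_measurable M"
  shows "integrable M (\<lambda>\<omega>. f (Y \<omega>))"
proof -
  have [measurable]: "f \<in> borel_measurable borel"
    using assms(1) by (rule borel_measurable_continuous_onI)
  show ?thesis
    using assms(2,3) by (intro integrable_const_bound[where B=B]) auto
qed

text \<open>The usual $O_P(1)$, in the form of a bound for all large indices: it is tightness of the sequence,
since each of the finitely many remaining terms is tight by itself.\<close>

definition bounded_in_probability ::
    "'a measure \<Rightarrow> (nat \<Rightarrow> 'a \<Rightarrow> 'c::real_normed_vector) \<Rightarrow> bool" where
  "bounded_in_probability M Y \<longleftrightarrow>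
     (\<forall>\<epsilon>>0. \<exists>K. \<forall>\<^sub>F n in sequentially. measure M {\<omega> \<in> space M. K < norm (Y n \<omega>)} < \<epsilon>)"

text \<open>Test the convergence on a continuous function that vanishes on the ball of radius \<open>K\<close> and equals 1
outside the ball of radius \<open>K + 1\<close>. Its expectation under the limit law tends to 0 as \<open>K\<close> grows, and
it dominates the indicator of the tail.\<close>

lemma converges_in_distribution_imp_bounded_in_probability:
  fixes Y :: "nat \<Rightarrow> 'a \<Rightarrow> 'c::euclidean_space"
  assumes M: "prob_space M" "prob_space M'" and YZ: "converges_in_distribution M Y M' Z"
  shows "bounded_in_probability M Y"
  unfolding bounded_in_probability_def
proof (intro allI impI)
  fix \<epsilon> :: real assume "0 < \<epsilon>"
  interpret M: prob_space M by fact
  interpret M': prob_space M' by fact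
  have Y[measurable]: "Y n \<in> borel_measurable M" and Z[measurable]: "Z \<in> borel_measurable M'" for n
    using YZ by (auto simp: converges_in_distribution_def)
  define h where "h K x = min 1 (max 0 (norm x - real K))" for K and x :: 'c
  have h: "continuous_on UNIV (h K)" "\<bar>h K x\<bar> \<le> 1" for K x
    unfolding h_def by (auto intro!: continuous_intros)
  have "(\<lambda>K. h K x) \<longlonglongrightarrow> 0" for x
  proof (rule tendsto_eventually)
    show "\<forall>\<^sub>F K in sequentially. h K x = 0"
      using eventually_ge_at_top[of "nat \<lceil>norm x\<rceil>"]
    proof eventually_elim
      case (elim K)
      then have "norm x \<le> real K" by linarith
      then show ?case by (simp add: h_def)
    qed
  qed
  then have "(\<lambda>K. \<integral>\<omega>. h K (Z \<omega>) \<partial>M') \<longlonglongrightarrow> (\<integral>\<omega>. 0 \<partial>M')"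
    using h(2) by (intro integral_dominated_convergence[where w="\<lambda>_. 1"])
      (auto intro!: borel_measurable_integrable M'.integrable_bounded_continuous[OF h Z])
  then have "\<forall>\<^sub>F K in sequentially. (\<integral>\<omega>. h K (Z \<omega>) \<partial>M') < \<epsilon>"
    using \<open>0 < \<epsilon>\<close> by (intro order_tendstoD(2)) auto
  then obtain K where K: "(\<integral>\<omega>. h K (Z \<omega>) \<partial>M') < \<epsilon>"
    by (auto simp: eventually_sequentially)
  have "(\<lambda>n. \<integral>\<omega>. h K (Y n \<omega>) \<partial>M) \<longlonglongrightarrow> (\<integral>\<omega>. h K (Z \<omega>) \<partial>M')"
  proof -
    have "bounded (range (h K))"
      using h(2) by (auto simp: bounded_iff)
    with YZ h(1) show ?thesis
      by (simp add: converges_in_distribution_def)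
  qed
  then have "\<forall>\<^sub>F n in sequentially. (\<integral>\<omega>. h K (Y n \<omega>) \<partial>M) < \<epsilon>"
    using K by (rule order_tendstoD)
  then have "\<forall>\<^sub>F n in sequentially. measure M {\<omega> \<in> space M. real K + 1 < norm (Y n \<omega>)} < \<epsilon>"
  proof eventually_elim
    case (elim n)
    have "measure M {\<omega> \<in> space M. real K + 1 < norm (Y n \<omega>)} =
        (\<integral>\<omega>. indicator {\<omega> \<in> space M. real K + 1 < norm (Y n \<omega>)} \<omega> \<partial>M)"
      by simp
    also have "\<dots> \<le> (\<integral>\<omega>. h K (Y n \<omega>) \<partial>M)"
      by (intro integral_mono M.integrable_bounded_continuous[OF h Y] integrable_real_indicator)
        (auto simp: h_def indicator_def M.emeasure_eq_measure)
    finally show ?case using elim by simp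
  qed
  then show "\<exists>K. \<forall>\<^sub>F n in sequentially. measure M {\<omega> \<in> space M. K < norm (Y n \<omega>)} < \<epsilon>"
    by blast
qed

lemma converges_in_distribution_const:
  assumes "Z \<in> borel_measurable M"
  shows "converges_in_distribution M (\<lambda>_. Z) M Z"
  using assms by (simp add: converges_in_distribution_def)

lemma converges_in_distribution_continuous_map:
  fixes g :: "'c::topological_space \<Rightarrow> 'd::topological_space"
  assumes "converges_in_distribution M Y M' Z" and g: "continuous_on UNIV g"
  shows "converges_in_distribution M (\<lambda>n \<omega>. g (Y n \<omega>)) M' (\<lambda>\<omega>. g (Z \<omega>))"
proof -
  have [measurable]: "g \<in> borel_measurable borel"
    using g by (rule borel_measurable_continuous_onI)
  have "continuous_on UNIV (\<lambda>x. f (g x))" if "continuous_on UNIV f" for f :: "'d \<Rightarrow> real"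
    using that g continuous_on_compose2 by blast
  moreover have "bounded (range (\<lambda>x. f (g x)))" if "bounded (range f)" for f :: "'d \<Rightarrow> real"
    using that by (rule bounded_subset) auto
  ultimately show ?thesis
    using assms(1) unfolding converges_in_distribution_def by (auto intro: measurable_compose)
qed

section \<open>Characteristic functions determine convergence in distribution\<close>

text \<open>Along a fixed direction this is the continuity theorem of Levy on the real line, with the argument
\<open>t\<close> absorbed into the direction.\<close>

lemma converges_in_distribution_inner_of_char:
  fixes Y :: "nat \<Rightarrow> 'a \<Rightarrow> 'c::euclidean_space"
  assumes M: "prob_space M" "prob_space M'"
    and Y: "\<And>n. Y n \<in> borel_measurable M" and Z: "Z \<in> borel_measurable M'"
    and char: "\<And>a. (\<lambda>n. \<integral>\<omega>. iexp (a \<bullet> Y n \<omega>) \<partial>M) \<longlonglongrightarrow> (\<integral>\<omega>. iexp (a \<bullet> Z \<omega>) \<partial>M')"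
  shows "converges_in_distribution M (\<lambda>n \<omega>. a \<bullet> Y n \<omega>) M' (\<lambda>\<omega>. a \<bullet> Z \<omega>)"
proof -
  interpret M: prob_space M by fact
  interpret M': prob_space M' by fact
  note Y[measurable] Z[measurable]
  have "char (distr M borel (\<lambda>\<omega>. a \<bullet> Y n \<omega>)) t = (\<integral>\<omega>. iexp ((t *\<^sub>R a) \<bullet> Y n \<omega>) \<partial>M)" for n t
    by (simp add: char_def integral_distr)
  moreover have "char (distr M' borel (\<lambda>\<omega>. a \<bullet> Z \<omega>)) t = (\<integral>\<omega>. iexp ((t *\<^sub>R a) \<bullet> Z \<omega>) \<partial>M')" for t
    by (simp add: char_def integral_distr)
  ultimately show ?thesis
    using char M
    by (subst converges_in_distribution_real_iff)
      (auto intro!: levy_continuity M.real_distribution_distr M'.real_distribution_distr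
        simp del: inner_scaleR_left of_real_mult)
qed

text \<open>Each coordinate converges in distribution and is therefore tight, and the norm of a vector is at most
the sum of the moduli of its coordinates.\<close>

lemma bounded_in_probability_of_char:
  fixes Y :: "nat \<Rightarrow> 'a \<Rightarrow> 'c::euclidean_space"
  assumes M: "prob_space M" "prob_space M'"
    and Y[measurable]: "\<And>n. Y n \<in> borel_measurable M" and Z: "Z \<in> borel_measurable M'"
    and char: "\<And>a. (\<lambda>n. \<integral>\<omega>. iexp (a \<bullet> Y n \<omega>) \<partial>M) \<longlonglongrightarrow> (\<integral>\<omega>. iexp (a \<bullet> Z \<omega>) \<partial>M')"
  shows "bounded_in_probability M Y"
  unfolding bounded_in_probability_def
proof (intro allI impI)
  fix \<epsilon> :: real assume "0 < \<epsilon>"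
  interpret M: prob_space M by fact
  have "\<exists>K. \<forall>\<^sub>F n in sequentially.
      measure M {\<omega> \<in> space M. K < norm (b \<bullet> Y n \<omega>)} < \<epsilon> / DIM('c)" for b :: 'c
    using converges_in_distribution_imp_bounded_in_probability[OF M
        converges_in_distribution_inner_of_char[OF M Y Z char, of b]] \<open>0 < \<epsilon>\<close>
    unfolding bounded_in_probability_def by simp
  then have "\<exists>K. \<forall>b :: 'c. \<forall>\<^sub>F n in sequentially.
      measure M {\<omega> \<in> space M. K b < norm (b \<bullet> Y n \<omega>)} < \<epsilon> / DIM('c)"
    by (intro choice allI)
  then obtain K where K: "\<And>b :: 'c. \<forall>\<^sub>F n in sequentially.
      measure M {\<omega> \<in> space M. K b < norm (b \<bullet> Y n \<omega>)} < \<epsilon> / DIM('c)"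
    by blast
  define K' where "K' = (\<Sum>b\<in>Basis. K b)"
  have "\<forall>\<^sub>F n in sequentially. \<forall>b\<in>Basis.
      measure M {\<omega> \<in> space M. K b < norm (b \<bullet> Y n \<omega>)} < \<epsilon> / DIM('c)"
    using K by (intro eventually_ball_finite) auto
  then have "\<forall>\<^sub>F n in sequentially. measure M {\<omega> \<in> space M. K' < norm (Y n \<omega>)} < \<epsilon>"
  proof eventually_elim
    case (elim n)
    have "{\<omega> \<in> space M. K' < norm (Y n \<omega>)} \<subseteq>
        (\<Union>b\<in>Basis. {\<omega> \<in> space M. K b < norm (b \<bullet> Y n \<omega>)})"
    proof safe
      fix \<omega> assume \<omega>: "\<omega> \<in> space M" "K' < norm (Y n \<omega>)"
      have "norm (Y n \<omega>) \<le> (\<Sum>b\<in>Basis. \<bar>Y n \<omega> \<bullet> b\<bar>)"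
        by (rule norm_le_l1)
      with \<omega> have "(\<Sum>b\<in>Basis. K b) < (\<Sum>b\<in>Basis. \<bar>Y n \<omega> \<bullet> b\<bar>)"
        by (simp add: K'_def)
      then obtain b where "b \<in> Basis" "K b < \<bar>Y n \<omega> \<bullet> b\<bar>"
        by (meson not_le sum_mono)
      with \<omega> show "\<omega> \<in> (\<Union>b\<in>Basis. {\<omega> \<in> space M. K b < norm (b \<bullet> Y n \<omega>)})"
        by (auto simp: inner_commute)
    qed
    then have "measure M {\<omega> \<in> space M. K' < norm (Y n \<omega>)} \<le>
        measure M (\<Union>b\<in>Basis. {\<omega> \<in> space M. K b < norm (b \<bullet> Y n \<omega>)})"
      by (intro M.finite_measure_mono) auto
    also have "\<dots> \<le> (\<Sum>b\<in>Basis. measure M {\<omega> \<in> space M. K b < norm (b \<bullet> Y n \<omega>)})"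
      by (intro M.finite_measure_subadditive_finite) auto
    also have "\<dots> < (\<Sum>b\<in>(Basis :: 'c set). \<epsilon> / DIM('c))"
      using elim by (intro sum_strict_mono) auto
    finally show ?case by simp
  qed
  then show "\<exists>K. \<forall>\<^sub>F n in sequentially. measure M {\<omega> \<in> space M. K < norm (Y n \<omega>)} < \<epsilon>"
    by blast
qed

lemma (in prob_space) integral_approx_off_tail:
  fixes f g :: "'c::euclidean_space \<Rightarrow> real"
  assumes f: "continuous_on UNIV f" "\<And>x. \<bar>f x\<bar> \<le> B"
    and g: "continuous_on UNIV g" "\<And>x. \<bar>g x\<bar> \<le> B + e"
    and fg: "\<And>x. norm x \<le> K \<Longrightarrow> \<bar>f x - g x\<bar> \<le> e" and "0 < e"
    and Y[measurable]: "Y \<in> borel_measurable M"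
  shows "\<bar>(\<integral>\<omega>. f (Y \<omega>) \<partial>M) - (\<integral>\<omega>. g (Y \<omega>) \<partial>M)\<bar> \<le>
    e + (2 * B + e) * measure M {\<omega> \<in> space M. K < norm (Y \<omega>)}"
proof -
  note int = integrable_bounded_continuous[OF f Y] integrable_bounded_continuous[OF g Y]
  let ?T = "{\<omega> \<in> space M. K < norm (Y \<omega>)}"
  have intT: "integrable M (\<lambda>\<omega>. e + (2 * B + e) * indicator ?T \<omega>)"
    by (intro Bochner_Integration.integrable_add integrable_mult_right integrable_real_indicator)
      (auto simp: emeasure_eq_measure)
  have "(\<integral>\<omega>. f (Y \<omega>) \<partial>M) - (\<integral>\<omega>. g (Y \<omega>) \<partial>M) = (\<integral>\<omega>. f (Y \<omega>) - g (Y \<omega>) \<partial>M)"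
    using int by simp
  also have "\<bar>\<dots>\<bar> \<le> (\<integral>\<omega>. \<bar>f (Y \<omega>) - g (Y \<omega>)\<bar> \<partial>M)"
    by (rule integral_abs_bound)
  also have "\<dots> \<le> (\<integral>\<omega>. e + (2 * B + e) * indicator ?T \<omega> \<partial>M)"
  proof (rule integral_mono)
    fix \<omega> assume "\<omega> \<in> space M"
    have "\<bar>f (Y \<omega>) - g (Y \<omega>)\<bar> \<le> 2 * B + e"
      using f(2)[of "Y \<omega>"] g(2)[of "Y \<omega>"] by linarith
    with \<open>\<omega> \<in> space M\<close> \<open>0 < e\<close> fg[of "Y \<omega>"]
    show "\<bar>f (Y \<omega>) - g (Y \<omega>)\<bar> \<le> e + (2 * B + e) * indicator ?T \<omega>"
      by (auto simp: indicator_def)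
  qed (use int intT in auto)
  also have "\<dots> = e + (2 * B + e) * measure M ?T"
    by (subst Bochner_Integration.integral_add)
      (auto simp: prob_space emeasure_eq_measure intro!: integrable_mult_right integrable_real_indicator)
  finally show ?thesis .
qed

lemma trig_polynomial_integral_converges:
  fixes Y :: "nat \<Rightarrow> 'a \<Rightarrow> 'c::euclidean_space"
  assumes M: "prob_space M" "prob_space M'"
    and Y: "\<And>n. Y n \<in> borel_measurable M" and Z: "Z \<in> borel_measurable M'"
    and char: "\<And>a. (\<lambda>n. \<integral>\<omega>. iexp (a \<bullet> Y n \<omega>) \<partial>M) \<longlonglongrightarrow> (\<integral>\<omega>. iexp (a \<bullet> Z \<omega>) \<partial>M')"
    and "trig_polynomial g"
  shows "(\<lambda>n. \<integral>\<omega>. g (Y n \<omega>) \<partial>M) \<longlonglongrightarrow> (\<integral>\<omega>. g (Z \<omega>) \<partial>M')"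
  using \<open>trig_polynomial g\<close>
proof induction
  case (wave c a t)
  have eq: "(\<integral>\<omega>. c * cos (a \<bullet> V \<omega> + t) \<partial>L) = c * Re (iexp t * (\<integral>\<omega>. iexp (a \<bullet> V \<omega>) \<partial>L))"
    if "prob_space L" and V[measurable]: "V \<in> borel_measurable L" for L :: "'l measure" and V
  proof -
    interpret L: prob_space L by fact
    have [simp]: "integrable L (\<lambda>\<omega>. iexp t * iexp (a \<bullet> V \<omega>))"
      by (intro integrable_mult_right L.integrable_iexp) auto
    have "c * cos (a \<bullet> V \<omega> + t) = c * Re (iexp t * iexp (a \<bullet> V \<omega>))" for \<omega>
      unfolding exp_add[symmetric] by (simp add: Re_exp add.commute)
    then have "(\<integral>\<omega>. c * cos (a \<bullet> V \<omega> + t) \<partial>L) = (\<integral>\<omega>. c * Re (iexp t * iexp (a \<bullet> V \<omega>)) \<partial>L)"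
      by presburger
    also have "\<dots> = c * Re (\<integral>\<omega>. iexp t * iexp (a \<bullet> V \<omega>) \<partial>L)"
      by (simp only: integral_mult_right_zero integral_Re \<open>integrable L _\<close>)
    finally show ?thesis
      by (simp only: integral_mult_right_zero)
  qed
  show ?case
    unfolding eq[OF M(1) Y] eq[OF M(2) Z] by (intro tendsto_intros char)
next
  case (add f g)
  have int: "integrable L (\<lambda>\<omega>. h (V \<omega>))"
    if "prob_space L" "trig_polynomial h" "V \<in> borel_measurable L"
    for L :: "'l measure" and V and h :: "'c \<Rightarrow> real"
    using trig_polynomial_bounded[OF that(2)] that
    by (auto intro: prob_space.integrable_bounded_continuous continuous_on_trig_polynomial)
  show ?case
    using tendsto_add[OF add.IH] int[OF M(1) add.hyps(1) Y] int[OF M(1) add.hyps(2) Y]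
      int[OF M(2) add.hyps(1) Z] int[OF M(2) add.hyps(2) Z] by simp
qed

text \<open>Levy's continuity theorem in several dimensions. A bounded continuous test function is replaced by
a trigonometric polynomial that is close to it on a large ball and not much larger elsewhere. The
expectation of the trigonometric polynomial converges by assumption, and tightness makes the
contribution from outside the ball negligible.\<close>

theorem converges_in_distribution_of_char:
  fixes Y :: "nat \<Rightarrow> 'a \<Rightarrow> 'c::euclidean_space"
  assumes M: "prob_space M" "prob_space M'"
    and Y: "\<And>n. Y n \<in> borel_measurable M" and Z: "Z \<in> borel_measurable M'"
    and char: "\<And>a. (\<lambda>n. \<integral>\<omega>. iexp (a \<bullet> Y n \<omega>) \<partial>M) \<longlonglongrightarrow> (\<integral>\<omega>. iexp (a \<bullet> Z \<omega>) \<partial>M')"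
  shows "converges_in_distribution M Y M' Z"
  unfolding converges_in_distribution_def
proof (intro conjI allI impI Y Z, elim conjE)
  fix f :: "'c \<Rightarrow> real"
  assume f: "continuous_on UNIV f" and "bounded (range f)"
  then obtain B where B: "\<And>x. \<bar>f x\<bar> \<le> B"
    by (auto simp: bounded_iff)
  have "0 \<le> B"
    using abs_ge_zero B order_trans by blast
  show "(\<lambda>n. \<integral>\<omega>. f (Y n \<omega>) \<partial>M) \<longlonglongrightarrow> (\<integral>\<omega>. f (Z \<omega>) \<partial>M')"
  proof (rule tendstoI)
    fix \<epsilon> :: real assume "0 < \<epsilon>"
    \<comment> \<open>The error splits into twice \<open>2 * e\<close> for replacing \<open>f\<close> by \<open>g\<close> and \<open>e\<close> for the
       convergence of the expectations of \<open>g\<close>.\<close>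
    define e where "e = \<epsilon> / 5"
    define \<delta> where "\<delta> = e / (2 * B + e)"
    have "0 < e"
      using \<open>0 < \<epsilon>\<close> by (simp add: e_def)
    then have "0 < 2 * B + e"
      using \<open>0 \<le> B\<close> by simp
    with \<open>0 < e\<close> have "0 < \<delta>" and \<delta>: "(2 * B + e) * \<delta> = e"
      by (simp_all add: \<delta>_def)
    have "bounded_in_probability M Y"
      using M Y Z char by (rule bounded_in_probability_of_char)
    then obtain K1 where K1:
      "\<forall>\<^sub>F n in sequentially. measure M {\<omega> \<in> space M. K1 < norm (Y n \<omega>)} < \<delta>"
      using \<open>0 < \<delta>\<close> unfolding bounded_in_probability_def by blast
    have "bounded_in_probability M' (\<lambda>_. Z)"
      using converges_in_distribution_imp_bounded_in_probability M(2) Z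
        converges_in_distribution_const by blast
    then obtain K2 where K2: "measure M' {\<omega> \<in> space M'. K2 < norm (Z \<omega>)} < \<delta>"
      using \<open>0 < \<delta>\<close> unfolding bounded_in_probability_def by force
    define K where "K = max K1 K2"
    obtain g where g: "trig_polynomial g" "\<And>x. norm x \<le> K \<Longrightarrow> \<bar>f x - g x\<bar> \<le> e"
      "\<And>x. \<bar>g x\<bar> \<le> B + e"
      using trig_polynomial_approximation[OF f B \<open>0 < e\<close>] by metis
    have close: "\<bar>(\<integral>\<omega>. f (V \<omega>) \<partial>L) - (\<integral>\<omega>. g (V \<omega>) \<partial>L)\<bar> \<le> 2 * e"
      if L: "prob_space L" and V[measurable]: "V \<in> borel_measurable L"
        and tail: "measure L {\<omega> \<in> space L. K0 < norm (V \<omega>)} < \<delta>" "K0 \<le> K"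
      for L :: "'l measure" and V K0
    proof -
      interpret L: prob_space L by fact
      have "measure L {\<omega> \<in> space L. K < norm (V \<omega>)} \<le> measure L {\<omega> \<in> space L. K0 < norm (V \<omega>)}"
        using tail(2) by (intro L.finite_measure_mono) auto
      with tail(1) have "(2 * B + e) * measure L {\<omega> \<in> space L. K < norm (V \<omega>)} \<le> (2 * B + e) * \<delta>"
        using \<open>0 \<le> B\<close> \<open>0 < e\<close> by (intro mult_left_mono) auto
      then show ?thesis
        using L.integral_approx_off_tail[OF f B continuous_on_trig_polynomial[OF g(1)] g(3) g(2)
            \<open>0 < e\<close> V, of K] \<delta> by simp
    qed
    have "\<forall>\<^sub>F n in sequentially. dist (\<integral>\<omega>. g (Y n \<omega>) \<partial>M) (\<integral>\<omega>. g (Z \<omega>) \<partial>M') < e"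
      using trig_polynomial_integral_converges[OF M Y Z char g(1)] \<open>0 < e\<close> by (rule tendstoD)
    with K1 show "\<forall>\<^sub>F n in sequentially. dist (\<integral>\<omega>. f (Y n \<omega>) \<partial>M) (\<integral>\<omega>. f (Z \<omega>) \<partial>M') < \<epsilon>"
    proof eventually_elim
      case (elim n)
      have "\<bar>(\<integral>\<omega>. f (Y n \<omega>) \<partial>M) - (\<integral>\<omega>. g (Y n \<omega>) \<partial>M)\<bar> \<le> 2 * e"
        using elim(1) by (rule close[OF M(1) Y]) (simp add: K_def)
      moreover have "\<bar>(\<integral>\<omega>. f (Z \<omega>) \<partial>M') - (\<integral>\<omega>. g (Z \<omega>) \<partial>M')\<bar> \<le> 2 * e"
        using K2 by (rule close[OF M(2) Z]) (simp add: K_def)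
      ultimately show ?case
        using elim(2) unfolding dist_real_def e_def by linarith
    qed
  qed
qed

lemma converges_in_distribution_imp_char:
  fixes Y :: "nat \<Rightarrow> 'a \<Rightarrow> 'c::euclidean_space"
  assumes M: "prob_space M" "prob_space M'" and YZ: "converges_in_distribution M Y M' Z"
  shows "(\<lambda>n. \<integral>\<omega>. iexp (a \<bullet> Y n \<omega>) \<partial>M) \<longlonglongrightarrow> (\<integral>\<omega>. iexp (a \<bullet> Z \<omega>) \<partial>M')"
proof -
  have Y: "Y n \<in> borel_measurable M" and Z: "Z \<in> borel_measurable M'" for n
    using YZ by (auto simp: converges_in_distribution_def)
  have eq: "(\<integral>\<omega>. iexp (a \<bullet> V \<omega>) \<partial>L) =
      Complex (\<integral>\<omega>. cos (a \<bullet> V \<omega>) \<partial>L) (\<integral>\<omega>. sin (a \<bullet> V \<omega>) \<partial>L)"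
    if "prob_space L" and V[measurable]: "V \<in> borel_measurable L" for L :: "'l measure" and V
  proof -
    interpret L: prob_space L by fact
    have "integrable L (\<lambda>\<omega>. iexp (a \<bullet> V \<omega>))"
      by (intro L.integrable_iexp) auto
    from integral_Re[OF this] integral_Im[OF this] show ?thesis
      by (simp add: complex_eq_iff Re_exp Im_exp)
  qed
  have "(\<lambda>n. \<integral>\<omega>. h (a \<bullet> Y n \<omega>) \<partial>M) \<longlonglongrightarrow> (\<integral>\<omega>. h (a \<bullet> Z \<omega>) \<partial>M')"
    if "continuous_on UNIV h" "\<And>x. \<bar>h x\<bar> \<le> 1" for h :: "real \<Rightarrow> real"
  proof -
    have "continuous_on UNIV (\<lambda>x. h (a \<bullet> x))"
      by (rule continuous_on_compose2[OF that(1)]) (auto intro!: continuous_intros)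
    moreover have "bounded (range (\<lambda>x. h (a \<bullet> x)))"
      using that(2) by (auto simp: bounded_iff)
    ultimately show ?thesis
      using YZ by (auto simp: converges_in_distribution_def)
  qed
  from this[of cos] this[of sin] show ?thesis
    unfolding eq[OF M(1) Y] eq[OF M(2) Z]
    by (intro tendsto_Complex)
      (simp_all add: continuous_on_cos[OF continuous_on_id] continuous_on_sin[OF continuous_on_id])
qed

section \<open>Slutsky's theorem and the delta method\<close>

text \<open>To show that an error is negligible it suffices to do so on the events where a tight sequence is
bounded. The tight sequence is typically the main term, which the error is a small multiple of.\<close>

lemma tendsto_0_in_probability_if_bounded:
  fixes Y :: "nat \<Rightarrow> 'a \<Rightarrow> 'c::real_normed_vector" and D :: "nat \<Rightarrow> 'a \<Rightarrow> 'd::real_normed_vector"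
  assumes M: "prob_space M"
    and [measurable]: "\<And>n. Y n \<in> borel_measurable M" "\<And>n. D n \<in> borel_measurable M"
    and Y: "bounded_in_probability M Y"
    and small: "\<And>K. (\<lambda>n. measure M {\<omega> \<in> space M. norm (Y n \<omega>) \<le> K \<and> e < norm (D n \<omega>)}) \<longlonglongrightarrow> 0"
  shows "(\<lambda>n. measure M {\<omega> \<in> space M. e < norm (D n \<omega>)}) \<longlonglongrightarrow> 0"
proof (rule tendstoI)
  fix \<epsilon> :: real assume "0 < \<epsilon>"
  interpret prob_space M by fact
  obtain K where "\<forall>\<^sub>F n in sequentially. measure M {\<omega> \<in> space M. K < norm (Y n \<omega>)} < \<epsilon> / 2"
    using Y \<open>0 < \<epsilon>\<close> half_gt_zero unfolding bounded_in_probability_def by blast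
  moreover have "\<forall>\<^sub>F n in sequentially.
      measure M {\<omega> \<in> space M. norm (Y n \<omega>) \<le> K \<and> e < norm (D n \<omega>)} < \<epsilon> / 2"
    using small \<open>0 < \<epsilon>\<close> by (intro order_tendstoD(2)) auto
  ultimately show "\<forall>\<^sub>F n in sequentially. dist (measure M {\<omega> \<in> space M. e < norm (D n \<omega>)}) 0 < \<epsilon>"
  proof eventually_elim
    case (elim n)
    have "measure M {\<omega> \<in> space M. e < norm (D n \<omega>)} \<le>
        measure M ({\<omega> \<in> space M. K < norm (Y n \<omega>)} \<union>
          {\<omega> \<in> space M. norm (Y n \<omega>) \<le> K \<and> e < norm (D n \<omega>)})"
      by (intro finite_measure_mono) auto
    also have "\<dots> \<le> measure M {\<omega> \<in> space M. K < norm (Y n \<omega>)} +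
        measure M {\<omega> \<in> space M. norm (Y n \<omega>) \<le> K \<and> e < norm (D n \<omega>)}"
      by (intro measure_Un_le) auto
    finally show ?case using elim by simp
  qed
qed

text \<open>Characteristic functions are insensitive to a perturbation that is small in probability, because
\<open>iexp\<close> is bounded and Lipschitz.\<close>

lemma converges_in_distribution_Slutsky:
  fixes Y Y' :: "nat \<Rightarrow> 'a \<Rightarrow> 'c::euclidean_space"
  assumes M: "prob_space M" "prob_space M'" and YZ: "converges_in_distribution M Y M' Z"
    and Y'[measurable]: "\<And>n. Y' n \<in> borel_measurable M"
    and small: "\<And>e. 0 < e \<Longrightarrow>
      (\<lambda>n. measure M {\<omega> \<in> space M. e < norm (Y' n \<omega> - Y n \<omega>)}) \<longlonglongrightarrow> 0"
  shows "converges_in_distribution M Y' M' Z"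
proof -
  interpret M: prob_space M by fact
  have Y[measurable]: "Y n \<in> borel_measurable M" and Z: "Z \<in> borel_measurable M'" for n
    using YZ by (auto simp: converges_in_distribution_def)
  show ?thesis
  proof (rule converges_in_distribution_of_char[OF M Y' Z])
    fix a :: 'c
    have "(\<lambda>n. (\<integral>\<omega>. iexp (a \<bullet> Y' n \<omega>) \<partial>M) - (\<integral>\<omega>. iexp (a \<bullet> Y n \<omega>) \<partial>M)) \<longlonglongrightarrow> 0"
    proof (rule tendstoI)
      fix \<epsilon> :: real assume "0 < \<epsilon>"
      define r where "r = norm a + 1"
      define e where "e = \<epsilon> / 2 / r"
      have r: "0 < r" "norm a \<le> r"
        by (simp_all add: r_def add_nonneg_pos)
      then have "0 < e" "r * e = \<epsilon> / 2"
        using \<open>0 < \<epsilon>\<close> by (simp_all add: e_def)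
      moreover from this r(2) have "norm a * e \<le> r * e"
        by (intro mult_right_mono) simp_all
      ultimately have e: "0 < e" "norm a * e \<le> \<epsilon> / 2"
        by linarith+
      have "\<forall>\<^sub>F n in sequentially. measure M {\<omega> \<in> space M. e < norm (Y' n \<omega> - Y n \<omega>)} < \<epsilon> / 4"
        using small[OF e(1)] \<open>0 < \<epsilon>\<close> by (intro order_tendstoD(2)) auto
      then show "\<forall>\<^sub>F n in sequentially.
          dist ((\<integral>\<omega>. iexp (a \<bullet> Y' n \<omega>) \<partial>M) - (\<integral>\<omega>. iexp (a \<bullet> Y n \<omega>) \<partial>M)) 0 < \<epsilon>"
      proof eventually_elim
        case (elim n)
        let ?T = "{\<omega> \<in> space M. e < norm (Y' n \<omega> - Y n \<omega>)}"
        have int: "integrable M (\<lambda>\<omega>. iexp (a \<bullet> Y' n \<omega>))" "integrable M (\<lambda>\<omega>. iexp (a \<bullet> Y n \<omega>))"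
          by (intro M.integrable_iexp; auto)+
        have intT: "integrable M (\<lambda>\<omega>. \<epsilon> / 2 + 2 * indicator ?T \<omega> :: real)"
          by (intro Bochner_Integration.integrable_add integrable_mult_right
              integrable_real_indicator) (auto simp: M.emeasure_eq_measure)
        have pointwise: "norm (iexp (a \<bullet> Y' n \<omega>) - iexp (a \<bullet> Y n \<omega>)) \<le>
            \<epsilon> / 2 + 2 * indicator ?T \<omega>" if "\<omega> \<in> space M" for \<omega>
        proof (cases "\<omega> \<in> ?T")
          case True
          have "norm (iexp (a \<bullet> Y' n \<omega>) - iexp (a \<bullet> Y n \<omega>)) \<le> 1 + 1"
            by (rule order_trans[OF norm_triangle_ineq4]) simp
          with True \<open>0 < \<epsilon>\<close> show ?thesis by simp
        next
          case False
          define d where "d = a \<bullet> Y' n \<omega> - a \<bullet> Y n \<omega>"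
          have "iexp (a \<bullet> Y' n \<omega>) - iexp (a \<bullet> Y n \<omega>) = iexp (a \<bullet> Y n \<omega>) * (iexp d - 1)"
            by (simp add: d_def algebra_simps flip: exp_add)
          then have "norm (iexp (a \<bullet> Y' n \<omega>) - iexp (a \<bullet> Y n \<omega>)) = norm (iexp d - 1)"
            by (simp add: norm_mult)
          also have "\<dots> \<le> \<bar>d\<bar>"
            using iexp_approx1[of d 0] by simp
          also have "\<dots> \<le> norm a * norm (Y' n \<omega> - Y n \<omega>)"
            unfolding d_def inner_diff_right[symmetric] by (rule Cauchy_Schwarz_ineq2)
          also have "\<dots> \<le> norm a * e"
            using False that by (intro mult_left_mono) auto
          finally show ?thesis
            using e(2) False by simp
        qed
        have "norm ((\<integral>\<omega>. iexp (a \<bullet> Y' n \<omega>) \<partial>M) - (\<integral>\<omega>. iexp (a \<bullet> Y n \<omega>) \<partial>M)) =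
            norm (\<integral>\<omega>. iexp (a \<bullet> Y' n \<omega>) - iexp (a \<bullet> Y n \<omega>) \<partial>M)"
          using int by simp
        also have "\<dots> \<le> (\<integral>\<omega>. \<epsilon> / 2 + 2 * indicator ?T \<omega> \<partial>M)"
          using int by (intro norm_integral_le intT pointwise) auto
        also have "\<dots> = \<epsilon> / 2 + 2 * measure M ?T"
          by (subst Bochner_Integration.integral_add)
            (auto simp: M.prob_space M.emeasure_eq_measure
              intro!: integrable_mult_right integrable_real_indicator)
        finally show ?case
          using elim by simp
      qed
    qed
    from tendsto_add[OF this converges_in_distribution_imp_char[OF M YZ, of a]]
    show "(\<lambda>n. \<integral>\<omega>. iexp (a \<bullet> Y' n \<omega>) \<partial>M) \<longlonglongrightarrow> (\<integral>\<omega>. iexp (a \<bullet> Z \<omega>) \<partial>M')"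
      by simp
  qed
qed

text \<open>The rescaled increment of \<open>T\<close> is tight, so \<open>T n - \<theta>\<close> is of order $n^{-1/2}$. On the events where the
rescaled increment is bounded, the remainder of the linearisation is therefore $o(n^{-1/2})$
uniformly, and it vanishes after multiplication by $\sqrt n$.\<close>

theorem delta_method:
  fixes T :: "nat \<Rightarrow> 'a \<Rightarrow> 'c::euclidean_space" and g :: "'c \<Rightarrow> 'd::euclidean_space"
  assumes M: "prob_space M" "prob_space M'"
    and TZ: "converges_in_distribution M (\<lambda>n \<omega>. sqrt (real n) *\<^sub>R (T n \<omega> - \<theta>)) M' Z"
    and g: "(g has_derivative g') (at \<theta>)"
    and gT[measurable]: "\<And>n. (\<lambda>\<omega>. g (T n \<omega>)) \<in> borel_measurable M"
  shows "converges_in_distribution M (\<lambda>n \<omega>. sqrt (real n) *\<^sub>R (g (T n \<omega>) - g \<theta>)) M' (\<lambda>\<omega>. g' (Z \<omega>))"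
proof -
  define Y where "Y n \<omega> = sqrt (real n) *\<^sub>R (T n \<omega> - \<theta>)" for n \<omega>
  have lin: "bounded_linear g'"
    using g by (rule has_derivative_bounded_linear)
  have cont: "continuous_on UNIV g'"
    by (rule linear_continuous_on[OF lin])
  have measY[measurable]: "Y n \<in> borel_measurable M" for n
    using TZ by (simp add: converges_in_distribution_def Y_def[abs_def])
  have [measurable]: "g' \<in> borel_measurable borel"
    using cont by (rule borel_measurable_continuous_onI)
  have YZ: "converges_in_distribution M (\<lambda>n \<omega>. g' (Y n \<omega>)) M' (\<lambda>\<omega>. g' (Z \<omega>))"
    unfolding Y_def by (rule converges_in_distribution_continuous_map[OF TZ cont])
  have bdd: "bounded_in_probability M Y"
    using converges_in_distribution_imp_bounded_in_probability[OF M TZ] by (simp add: Y_def[abs_def])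
  show ?thesis
  proof (rule converges_in_distribution_Slutsky[OF M YZ])
    fix e :: real assume "0 < e"
    show "(\<lambda>n. measure M {\<omega> \<in> space M.
        e < norm (sqrt (real n) *\<^sub>R (g (T n \<omega>) - g \<theta>) - g' (Y n \<omega>))}) \<longlonglongrightarrow> 0"
    proof (rule tendsto_0_in_probability_if_bounded[OF M(1) measY _ bdd])
      fix K :: real
      define \<eta> where "\<eta> = e / (\<bar>K\<bar> + 1)"
      have \<eta>: "0 < \<eta>" "\<eta> * \<bar>K\<bar> \<le> e"
        using \<open>0 < e\<close> by (auto simp: \<eta>_def field_simps)
      then obtain d where d: "0 < d"
        "\<And>x. norm (x - \<theta>) < d \<Longrightarrow> norm (g x - g \<theta> - g' (x - \<theta>)) \<le> \<eta> * norm (x - \<theta>)"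
        using g unfolding has_derivative_at_alt by blast
      have "\<forall>\<^sub>F n in sequentially. K / d < sqrt (real n)"
        by real_asymp
      then have "\<forall>\<^sub>F n in sequentially. {\<omega> \<in> space M. norm (Y n \<omega>) \<le> K \<and>
          e < norm (sqrt (real n) *\<^sub>R (g (T n \<omega>) - g \<theta>) - g' (Y n \<omega>))} = {}"
        using eventually_gt_at_top[of 0]
      proof eventually_elim
        case (elim n)
        have "norm (sqrt (real n) *\<^sub>R (g (T n \<omega>) - g \<theta>) - g' (Y n \<omega>)) \<le> e"
          if "norm (Y n \<omega>) \<le> K" for \<omega>
        proof -
          have pos: "0 < sqrt (real n)" using elim by simp
          have nY: "norm (Y n \<omega>) = sqrt (real n) * norm (T n \<omega> - \<theta>)"
            by (simp add: Y_def)
          have "K < sqrt (real n) * d"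
            using elim d(1) by (simp add: field_simps)
          then have "sqrt (real n) * norm (T n \<omega> - \<theta>) < sqrt (real n) * d"
            using that nY by simp
          then have "norm (T n \<omega> - \<theta>) < d"
            using pos by simp
          note R = d(2)[OF this]
          have "g' (Y n \<omega>) = sqrt (real n) *\<^sub>R g' (T n \<omega> - \<theta>)"
            unfolding Y_def by (rule linear_scale[OF bounded_linear.linear[OF lin]])
          then have "norm (sqrt (real n) *\<^sub>R (g (T n \<omega>) - g \<theta>) - g' (Y n \<omega>)) =
              norm (sqrt (real n) *\<^sub>R (g (T n \<omega>) - g \<theta> - g' (T n \<omega> - \<theta>)))"
            by (simp add: scaleR_diff_right)
          also have "\<dots> = sqrt (real n) * norm (g (T n \<omega>) - g \<theta> - g' (T n \<omega> - \<theta>))"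
            by simp
          also have "\<dots> \<le> sqrt (real n) * (\<eta> * norm (T n \<omega> - \<theta>))"
            using R pos by (intro mult_left_mono) auto
          also have "\<dots> = \<eta> * norm (Y n \<omega>)"
            by (simp add: nY)
          also have "\<dots> \<le> \<eta> * \<bar>K\<bar>"
            using that \<eta>(1) by (intro mult_left_mono) auto
          finally show ?thesis using \<eta>(2) by simp
        qed
        then show ?case by (auto simp: not_less)
      qed
      then show "(\<lambda>n. measure M {\<omega> \<in> space M. norm (Y n \<omega>) \<le> K \<and>
          e < norm (sqrt (real n) *\<^sub>R (g (T n \<omega>) - g \<theta>) - g' (Y n \<omega>))}) \<longlonglongrightarrow> 0"
        by (intro tendsto_eventually) (elim eventually_mono, simp only: measure_empty)
    qed measurable
  qed measurable
qed

section \<open>Irreducible stochastic matrices\<close>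

lemma matrix_power_Suc: "matrix_power A (Suc k) = A ** matrix_power A k"
  by (simp add: matrix_power_def)

lemma matrix_power_0: "matrix_power A 0 = mat 1"
  by (simp add: matrix_power_def)

lemma stochastic_matrix_mult_one: "stochastic_matrix P \<Longrightarrow> P *v 1 = 1"
  by (simp add: stochastic_matrix_def matrix_vector_mult_def vec_eq_iff)

lemma matrix_power_mult_fixed:
  assumes "A *v g = g"
  shows "matrix_power A k *v g = g"
proof (induction k)
  case (Suc k)
  then show ?case
    using assms by (simp add: matrix_power_Suc flip: matrix_vector_mul_assoc)
qed (simp add: matrix_power_0)

lemma vector_mult_matrix_power_fixed:
  assumes "p v* A = p"
  shows "p v* matrix_power A k = p"
proof (induction k)
  case (Suc k)
  then show ?case
    using assms by (simp add: matrix_power_Suc flip: vector_matrix_mul_assoc)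
qed (simp add: matrix_power_0)

lemma matrix_power_nonneg:
  assumes "stochastic_matrix P"
  shows "0 \<le> matrix_power P k $ i $ j"
proof (induction k arbitrary: i)
  case 0
  show ?case by (simp add: matrix_power_0 mat_def)
next
  case (Suc k)
  then show ?case
    using assms by (auto simp: matrix_power_Suc matrix_matrix_mult_def stochastic_matrix_def
        intro!: sum_nonneg)
qed

lemma stochastic_matrix_power:
  assumes "stochastic_matrix P"
  shows "stochastic_matrix (matrix_power P k)"
  using matrix_power_nonneg[OF assms] matrix_power_mult_fixed[OF stochastic_matrix_mult_one[OF assms]]
  by (simp add: stochastic_matrix_def matrix_vector_mult_def vec_eq_iff)

text \<open>The maximum principle: the value at a maximal state is an average of the values at all states
reachable from it, and irreducibility makes every state reachable.\<close>

lemma harmonic_imp_constant: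
  assumes P: "stochastic_matrix P" "irreducible_matrix P" and g: "P *v g = g"
  shows "g $ i = g $ j"
proof -
  obtain m where m: "\<And>l. g $ l \<le> g $ m"
  proof -
    have "Max (range (\<lambda>l. g $ l)) \<in> range (\<lambda>l. g $ l)"
      by (rule Max_in) auto
    then obtain m where "Max (range (\<lambda>l. g $ l)) = g $ m" by blast
    then have "g $ l \<le> g $ m" for l
      using Max_ge[of "range (\<lambda>l. g $ l)" "g $ l"] by simp
    then show ?thesis using that by blast
  qed
  have "g $ l = g $ m" for l
  proof -
    obtain k where k: "0 < matrix_power P k $ m $ l"
      using P(2) unfolding irreducible_matrix_def by blast
    let ?Q = "matrix_power P k"
    have Q: "\<And>i j. 0 \<le> ?Q $ i $ j" "\<And>i. (\<Sum>j\<in>UNIV. ?Q $ i $ j) = 1"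
      using stochastic_matrix_power[OF P(1), of k] by (auto simp: stochastic_matrix_def)
    have "(\<Sum>j\<in>UNIV. ?Q $ m $ j * g $ j) = g $ m"
      using matrix_power_mult_fixed[OF g, of k]
      by (simp add: matrix_vector_mult_def vec_eq_iff)
    then have "(\<Sum>j\<in>UNIV. ?Q $ m $ j * (g $ m - g $ j)) = 0"
      using Q(2)[of m] by (simp add: right_diff_distrib sum_subtractf flip: sum_distrib_right)
    then have "?Q $ m $ l * (g $ m - g $ l) = 0"
      using Q(1) m by (subst (asm) sum_nonneg_eq_0_iff) auto
    with k show ?thesis by simp
  qed
  from this[of i] this[of j] show ?thesis by simp
qed

lemma stationary_vector_pos:
  assumes P: "stochastic_matrix P" "irreducible_matrix P" and p: "stationary_vector P p"
  shows "0 < p $ j"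
proof -
  have nonneg: "\<And>i. 0 \<le> p $ i" and one: "(\<Sum>i\<in>UNIV. p $ i) = 1" and fixed: "p v* P = p"
    using p by (auto simp: stationary_vector_def)
  obtain i where i: "0 < p $ i"
    using one nonneg by (metis less_eq_real_def sum.neutral zero_neq_one)
  obtain k where k: "0 < matrix_power P k $ i $ j"
    using P(2) unfolding irreducible_matrix_def by blast
  have "0 < p $ i * matrix_power P k $ i $ j"
    using i k by simp
  also have "\<dots> \<le> (\<Sum>l\<in>UNIV. p $ l * matrix_power P k $ l $ j)"
    using nonneg matrix_power_nonneg[OF P(1)] by (intro member_le_sum) auto
  also have "\<dots> = p $ j"
    using vector_mult_matrix_power_fixed[OF fixed, of k]
    by (simp add: vector_matrix_mult_def vec_eq_iff mult.commute)
  finally show ?thesis .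
qed

text \<open>By the maximum principle, \<open>g - P *v g + (p \<bullet> g) *\<^sub>R 1\<close> determines \<open>g\<close>, so this linear map is also
onto. Pairing with the stationary vector shows that the rank-one correction vanishes whenever
the right-hand side has mean zero. The solution \<open>g\<close> turns sums along the chain into
martingales plus a bounded term.\<close>

lemma Poisson_equation:
  fixes P :: "real^'s^'s"
  assumes P: "stochastic_matrix P" "irreducible_matrix P" and p: "stationary_vector P p"
  obtains g where "\<And>i. f i - (\<Sum>l\<in>UNIV. p $ l * f l) = g i - (\<Sum>j\<in>UNIV. P $ i $ j * g j)"
proof -
  have one: "p \<bullet> 1 = 1" and fixed: "p v* P = p"
    using p by (simp_all add: stationary_vector_def inner_vec_def)
  define T where "T g = g - P *v g + (p \<bullet> g) *\<^sub>R 1" for g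
  have "linear T"
    unfolding T_def
    by (intro linearI) (simp_all add: matrix_vector_right_distrib inner_add_right
        scaleR_add_left matrix_vector_mult_scaleR scaleR_diff_right algebra_simps)
  have pT: "p \<bullet> T g = p \<bullet> g" for g
    using dot_lmul_matrix[of p P g] fixed one
    by (simp add: T_def inner_add_right inner_diff_right)
  have "g = 0" if "T g = 0" for g
  proof -
    have "p \<bullet> g = 0"
      using pT[of g] that by simp
    with that have "P *v g = g"
      by (simp add: T_def)
    then have const: "g = (g $ undefined) *\<^sub>R 1"
      using harmonic_imp_constant[OF P] by (simp add: vec_eq_iff)
    then have "p \<bullet> g = g $ undefined"
      using one by (metis inner_scaleR_right mult.right_neutral)
    with \<open>p \<bullet> g = 0\<close> const show "g = 0" by simp
  qed
  then have "inj T"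
    using linear_injective_0[OF \<open>linear T\<close>] by blast
  then have "surj T"
    using linear_injective_imp_surjective[OF \<open>linear T\<close>] by simp
  define f' where "f' = (\<chi> i. f i - (\<Sum>l\<in>UNIV. p $ l * f l))"
  obtain g where g: "T g = f'"
    using surjD[OF \<open>surj T\<close>, of f'] by auto
  have "p \<bullet> f' = 0"
    using p by (simp add: f'_def inner_vec_def stationary_vector_def right_diff_distrib
        sum_subtractf flip: sum_distrib_right)
  then have "p \<bullet> g = 0"
    using pT[of g] g by simp
  then have "g - P *v g = f'"
    using g by (simp add: T_def)
  then have "f i - (\<Sum>l\<in>UNIV. p $ l * f l) = g $ i - (\<Sum>j\<in>UNIV. P $ i $ j * g $ j)" for i
    by (simp add: f'_def vec_eq_iff matrix_vector_mult_def)
  then show ?thesis by (rule that)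
qed

lemma finite_type_bounded2:
  fixes c :: "'s::finite \<Rightarrow> 't::finite \<Rightarrow> real"
  obtains C where "\<And>i j. \<bar>c i j\<bar> \<le> C"
proof (rule that)
  show "\<bar>c i j\<bar> \<le> Max (range (\<lambda>(i, j). \<bar>c i j\<bar>))" for i j
    by (intro Max_ge) (auto intro: rev_image_eqI[of "(i, j)"])
qed

section \<open>The martingale property of a Markov chain\<close>

text \<open>Adaptedness in coordinates: the functional of the trajectory is known at time \<open>n\<close>. Over a
finite state space such a functional takes finitely many values.\<close>

definition depends_on_prefix :: "nat \<Rightarrow> ((nat \<Rightarrow> 's) \<Rightarrow> 'c) \<Rightarrow> bool" where
  "depends_on_prefix n G \<longleftrightarrow> (\<forall>x y. (\<forall>m\<le>n. x m = y m) \<longrightarrow> G x = G y)"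

lemma depends_on_prefixI:
  "(\<And>x y. (\<And>m. m \<le> n \<Longrightarrow> x m = y m) \<Longrightarrow> G x = G y) \<Longrightarrow> depends_on_prefix n G"
  unfolding depends_on_prefix_def by blast

locale finite_markov_chain =
  fixes M :: "'a measure" and X :: "nat \<Rightarrow> 'a \<Rightarrow> 's::finite" and P :: "real^'s^'s"
  assumes chain: "markov_chain M X P" and stochastic: "stochastic_matrix P"
begin

sublocale prob_space M
  using chain by (simp add: markov_chain_def)

lemma measurable_X[measurable]: "X n \<in> measurable M (count_space UNIV)"
  using chain by (simp add: markov_chain_def)

lemma P_nonneg: "0 \<le> P $ i $ j" and P_row_sum: "(\<Sum>j\<in>UNIV. P $ i $ j) = 1"
  using stochastic by (auto simp: stochastic_matrix_def)

definition trajectory :: "'a \<Rightarrow> nat \<Rightarrow> 's" where "trajectory \<omega> = (\<lambda>m. X m \<omega>)"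

definition cylinder :: "nat \<Rightarrow> (nat \<Rightarrow> 's) \<Rightarrow> 'a set" where
  "cylinder n x = {\<omega> \<in> space M. \<forall>m\<le>n. X m \<omega> = x m}"

abbreviation prefixes :: "nat \<Rightarrow> (nat \<Rightarrow> 's) set" where
  "prefixes n \<equiv> PiE {..n} (\<lambda>_. UNIV)"

lemma cylinder_sets[measurable]: "cylinder n x \<in> sets M"
  unfolding cylinder_def by measurable

lemma prob_cylinder_step:
  "prob (cylinder n x \<inter> {\<omega> \<in> space M. X (Suc n) \<omega> = j}) = prob (cylinder n x) * P $ x n $ j"
proof (cases "prob (cylinder n x) = 0")
  case True
  have "prob (cylinder n x \<inter> {\<omega> \<in> space M. X (Suc n) \<omega> = j}) \<le> prob (cylinder n x)"
    by (intro finite_measure_mono) auto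
  with True show ?thesis
    using measure_nonneg[of M "cylinder n x \<inter> {\<omega> \<in> space M. X (Suc n) \<omega> = j}"] by simp
next
  case False
  then have pos: "0 < \<P>(\<omega> in M. \<forall>m\<le>n. X m \<omega> = x m)"
    by (simp add: cylinder_def zero_less_measure_iff)
  then have "\<P>(\<omega> in M. X (Suc n) \<omega> = j \<bar> \<forall>m\<le>n. X m \<omega> = x m) = P $ x n $ j"
    using chain by (auto simp: markov_chain_def)
  moreover have "cylinder n x \<inter> {\<omega> \<in> space M. X (Suc n) \<omega> = j} =
      {\<omega> \<in> space M. X (Suc n) \<omega> = j \<and> (\<forall>m\<le>n. X m \<omega> = x m)}"
    by (auto simp: cylinder_def)
  ultimately show ?thesis
    using pos by (simp add: cond_prob_def cylinder_def field_simps)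
qed

lemma prefix_expansion:
  fixes G :: "(nat \<Rightarrow> 's) \<Rightarrow> 'c::real_vector"
  assumes "depends_on_prefix n G" "\<omega> \<in> space M"
  shows "(\<Sum>x\<in>prefixes n. indicator (cylinder n x) \<omega> *\<^sub>R G x) = G (trajectory \<omega>)"
proof -
  let ?r = "restrict (trajectory \<omega>) {..n}"
  have "(\<Sum>x\<in>prefixes n. indicator (cylinder n x) \<omega> *\<^sub>R G x) =
      (\<Sum>x\<in>prefixes n. if x = ?r then G ?r else 0)"
  proof (rule sum.cong[OF refl])
    fix x assume "x \<in> prefixes n"
    then have "\<omega> \<in> cylinder n x \<longleftrightarrow> x = ?r"
      using assms(2) by (auto simp: cylinder_def trajectory_def fun_eq_iff PiE_def extensional_def)
    then show "indicator (cylinder n x) \<omega> *\<^sub>R G x = (if x = ?r then G ?r else 0)"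
      by (simp add: indicator_def)
  qed
  also have "\<dots> = G ?r"
    by (subst sum.delta) (auto intro!: finite_PiE)
  also have "\<dots> = G (trajectory \<omega>)"
    using assms(1) by (auto simp: depends_on_prefix_def)
  finally show ?thesis .
qed

lemma integrable_prefix:
  fixes G :: "(nat \<Rightarrow> 's) \<Rightarrow> 'c::{banach, second_countable_topology}"
  assumes "depends_on_prefix n G"
  shows "integrable M (\<lambda>\<omega>. G (trajectory \<omega>))"
proof -
  have "integrable M (\<lambda>\<omega>. \<Sum>x\<in>prefixes n. indicator (cylinder n x) \<omega> *\<^sub>R G x)"
      (is "integrable M ?F")
    by (intro Bochner_Integration.integrable_sum integrable_scaleR_left integrable_real_indicator)
      (auto simp: emeasure_eq_measure)
  moreover have "integrable M ?F \<longleftrightarrow> integrable M (\<lambda>\<omega>. G (trajectory \<omega>))"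
    by (rule Bochner_Integration.integrable_cong[OF refl prefix_expansion[OF assms]])
  ultimately show ?thesis by simp
qed

text \<open>The Markov property in the form of a conditional expectation given the past: split according to
the finitely many prefixes and apply the transition probability on each cylinder.\<close>

lemma markov_property_expectation:
  fixes G :: "(nat \<Rightarrow> 's) \<Rightarrow> 'c::{banach, second_countable_topology, real_normed_field}"
  assumes G: "depends_on_prefix n G"
  shows "(\<integral>\<omega>. G (trajectory \<omega>) * h (X n \<omega>) (X (Suc n) \<omega>) \<partial>M) =
    (\<integral>\<omega>. G (trajectory \<omega>) * (\<Sum>j\<in>UNIV. of_real (P $ X n \<omega> $ j) * h (X n \<omega>) j) \<partial>M)"
proof -
  let ?E = "\<lambda>x j. cylinder n x \<inter> {\<omega> \<in> space M. X (Suc n) \<omega> = j}"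
  have "(\<integral>\<omega>. G (trajectory \<omega>) * h (X n \<omega>) (X (Suc n) \<omega>) \<partial>M) =
      (\<integral>\<omega>. (\<Sum>j\<in>UNIV. \<Sum>x\<in>prefixes n. indicator (?E x j) \<omega> *\<^sub>R (G x * h (x n) j)) \<partial>M)"
  proof (rule Bochner_Integration.integral_cong[OF refl])
    fix \<omega> assume \<omega>: "\<omega> \<in> space M"
    have "(\<Sum>x\<in>prefixes n. indicator (?E x j) \<omega> *\<^sub>R (G x * h (x n) j)) =
        (if X (Suc n) \<omega> = j then G (trajectory \<omega>) * h (X n \<omega>) j else 0)" for j
    proof -
      have "depends_on_prefix n (\<lambda>x. G x * h (x n) j)"
        using G by (auto simp: depends_on_prefix_def)
      from prefix_expansion[OF this \<omega>] \<omega> show ?thesis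
        by (auto simp: indicator_inter_arith trajectory_def)
    qed
    then show "G (trajectory \<omega>) * h (X n \<omega>) (X (Suc n) \<omega>) =
        (\<Sum>j\<in>UNIV. \<Sum>x\<in>prefixes n. indicator (?E x j) \<omega> *\<^sub>R (G x * h (x n) j))"
      by (simp add: sum.delta)
  qed
  also have "\<dots> = (\<Sum>j\<in>UNIV. \<Sum>x\<in>prefixes n. prob (?E x j) *\<^sub>R (G x * h (x n) j))"
    by (subst Bochner_Integration.integral_sum
        | intro Bochner_Integration.integrable_sum integrable_scaleR_left integrable_real_indicator
        | simp add: emeasure_eq_measure)+
  also have "\<dots> = (\<Sum>x\<in>prefixes n. prob (cylinder n x) *\<^sub>R
      (G x * (\<Sum>j\<in>UNIV. of_real (P $ x n $ j) * h (x n) j)))"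
    by (subst sum.swap)
      (simp add: prob_cylinder_step sum_distrib_left scaleR_sum_right scaleR_conv_of_real mult_ac)
  also have "\<dots> = (\<integral>\<omega>. (\<Sum>x\<in>prefixes n. indicator (cylinder n x) \<omega> *\<^sub>R
      (G x * (\<Sum>j\<in>UNIV. of_real (P $ x n $ j) * h (x n) j))) \<partial>M)"
    by (subst Bochner_Integration.integral_sum
        | intro integrable_scaleR_left integrable_real_indicator
        | simp add: emeasure_eq_measure)+
  also have "\<dots> = (\<integral>\<omega>. G (trajectory \<omega>) * (\<Sum>j\<in>UNIV. of_real (P $ X n \<omega> $ j) * h (X n \<omega>) j) \<partial>M)"
  proof (rule Bochner_Integration.integral_cong[OF refl])
    fix \<omega> assume \<omega>: "\<omega> \<in> space M"
    have "depends_on_prefix n (\<lambda>x. G x * (\<Sum>j\<in>UNIV. of_real (P $ x n $ j) * h (x n) j))"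
      using G by (auto simp: depends_on_prefix_def)
    from prefix_expansion[OF this \<omega>]
    show "(\<Sum>x\<in>prefixes n. indicator (cylinder n x) \<omega> *\<^sub>R
        (G x * (\<Sum>j\<in>UNIV. of_real (P $ x n $ j) * h (x n) j))) =
        G (trajectory \<omega>) * (\<Sum>j\<in>UNIV. of_real (P $ X n \<omega> $ j) * h (X n \<omega>) j)"
      by (simp add: trajectory_def)
  qed
  finally show ?thesis .
qed

text \<open>When the increments \<open>c\<close> have conditional mean 0, that is \<open>\<Sum>j. P $ i $ j * c i j = 0\<close> for every \<open>i\<close>, this
process is a martingale. That condition is the hypothesis \<open>mart\<close> below.\<close>

definition additive_functional :: "('s \<Rightarrow> 's \<Rightarrow> real) \<Rightarrow> nat \<Rightarrow> 'a \<Rightarrow> real" where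
  "additive_functional c n \<omega> = (\<Sum>m<n. c (X m \<omega>) (X (Suc m) \<omega>))"

lemma additive_functional_measurable[measurable]:
  "additive_functional c n \<in> borel_measurable M"
proof -
  have "integrable M (\<lambda>\<omega>. (\<lambda>x. \<Sum>m<n. c (x m) (x (Suc m))) (trajectory \<omega>))"
    by (intro integrable_prefix[where n=n] depends_on_prefixI sum.cong) auto
  then show ?thesis
    by (simp add: additive_functional_def[abs_def] trajectory_def)
qed

text \<open>Martingale increments are orthogonal, so their second moments add up.\<close>

lemma martingale_second_moment:
  assumes mart: "\<And>i. (\<Sum>j\<in>UNIV. P $ i $ j * c i j) = 0" and C: "\<And>i j. \<bar>c i j\<bar> \<le> C"
  shows "(\<integral>\<omega>. (additive_functional c n \<omega>)\<^sup>2 \<partial>M) \<le> real n * C\<^sup>2"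
proof (induction n)
  case 0
  show ?case by (simp add: additive_functional_def)
next
  case (Suc n)
  let ?S = "\<lambda>x. \<Sum>m<n. c (x m) (x (Suc m))"
  let ?d = "\<lambda>\<omega>. c (X n \<omega>) (X (Suc n) \<omega>)"
  have S: "additive_functional c n \<omega> = ?S (trajectory \<omega>)" for \<omega>
    by (simp add: additive_functional_def trajectory_def)
  have dep: "depends_on_prefix n ?S"
    by (intro depends_on_prefixI sum.cong) auto
  have int: "integrable M (\<lambda>\<omega>. (additive_functional c n \<omega>)\<^sup>2)"
    unfolding S using dep by (intro integrable_prefix[where n=n]) (simp add: depends_on_prefix_def)
  have int_cross: "integrable M (\<lambda>\<omega>. additive_functional c n \<omega> * ?d \<omega>)"
  proof -
    have "integrable M (\<lambda>\<omega>. (\<lambda>x. ?S x * c (x n) (x (Suc n))) (trajectory \<omega>))"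
      by (intro integrable_prefix[where n="Suc n"] depends_on_prefixI)
        (auto intro!: arg_cong2[where f="(*)"] sum.cong)
    then show ?thesis by (simp add: S) (simp add: trajectory_def)
  qed
  have int_d: "integrable M (\<lambda>\<omega>. (?d \<omega>)\<^sup>2)"
  proof -
    have "integrable M (\<lambda>\<omega>. (\<lambda>x. (c (x n) (x (Suc n)))\<^sup>2) (trajectory \<omega>))"
      by (intro integrable_prefix[where n="Suc n"] depends_on_prefixI) auto
    then show ?thesis by (simp add: trajectory_def)
  qed
  have "(\<integral>\<omega>. additive_functional c n \<omega> * ?d \<omega> \<partial>M) = 0"
    unfolding S using markov_property_expectation[OF dep, of c] mart by simp
  moreover have "(\<integral>\<omega>. (?d \<omega>)\<^sup>2 \<partial>M) \<le> C\<^sup>2"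
  proof -
    have "(\<integral>\<omega>. (?d \<omega>)\<^sup>2 \<partial>M) \<le> (\<integral>\<omega>. C\<^sup>2 \<partial>M)"
      using int_d C by (intro integral_mono) (auto simp: abs_le_square_iff[symmetric] intro: order_trans[OF _ abs_ge_self])
    then show ?thesis by (simp add: prob_space)
  qed
  moreover have "(\<integral>\<omega>. (additive_functional c (Suc n) \<omega>)\<^sup>2 \<partial>M) =
      (\<integral>\<omega>. (additive_functional c n \<omega>)\<^sup>2 + 2 * (additive_functional c n \<omega> * ?d \<omega>) + (?d \<omega>)\<^sup>2 \<partial>M)"
    by (intro Bochner_Integration.integral_cong)
      (auto simp: additive_functional_def power2_eq_square algebra_simps)
  moreover have "\<dots> = (\<integral>\<omega>. (additive_functional c n \<omega>)\<^sup>2 \<partial>M) +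
      2 * (\<integral>\<omega>. additive_functional c n \<omega> * ?d \<omega> \<partial>M) + (\<integral>\<omega>. (?d \<omega>)\<^sup>2 \<partial>M)"
    using int int_cross int_d by simp
  ultimately show ?case
    using Suc.IH by (simp add: algebra_simps)
qed

lemma martingale_first_moment:
  assumes mart: "\<And>i. (\<Sum>j\<in>UNIV. P $ i $ j * c i j) = 0" and C: "\<And>i j. \<bar>c i j\<bar> \<le> C"
  shows "(\<integral>\<omega>. \<bar>additive_functional c n \<omega>\<bar> \<partial>M) \<le> sqrt (real n) * C"
proof -
  have int: "integrable M (\<lambda>\<omega>. \<bar>additive_functional c n \<omega>\<bar> ^ k)" for k
  proof -
    have "integrable M (\<lambda>\<omega>. (\<lambda>x. \<bar>\<Sum>m<n. c (x m) (x (Suc m))\<bar> ^ k) (trajectory \<omega>))"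
      by (intro integrable_prefix[where n=n] depends_on_prefixI arg_cong2[where f="(^)"]
          arg_cong[where f=abs] sum.cong) auto
    then show ?thesis by (simp add: trajectory_def additive_functional_def)
  qed
  have "(\<integral>\<omega>. \<bar>additive_functional c n \<omega>\<bar> \<partial>M)\<^sup>2 \<le> (\<integral>\<omega>. \<bar>additive_functional c n \<omega>\<bar>\<^sup>2 \<partial>M)"
    using variance_positive[of "\<lambda>\<omega>. \<bar>additive_functional c n \<omega>\<bar>"] int[of 1] int[of 2]
    by (subst (asm) variance_eq) auto
  also have "\<dots> \<le> real n * C\<^sup>2"
    using martingale_second_moment[OF mart C] by simp
  also have "\<dots> = (sqrt (real n) * C)\<^sup>2"
    by (simp add: power_mult_distrib)
  finally have le: "(\<integral>\<omega>. \<bar>additive_functional c n \<omega>\<bar> \<partial>M)\<^sup>2 \<le> (sqrt (real n) * C)\<^sup>2" .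
  have "0 \<le> sqrt (real n) * C"
    by (intro mult_nonneg_nonneg real_sqrt_ge_zero of_nat_0_le_iff order_trans[OF abs_ge_zero C])
  with le show ?thesis
    by (rule power2_le_imp_le)
qed

end

section \<open>The ergodic theorem in mean\<close>

locale irreducible_markov_chain = finite_markov_chain M X P
  for M :: "'a measure" and X :: "nat \<Rightarrow> 'a \<Rightarrow> 's::finite" and P :: "real^'s^'s" +
  fixes p :: "real^'s"
  assumes irreducible: "irreducible_matrix P" and stationary: "stationary_vector P p"
begin

lemma p_pos: "0 < p $ i"
  by (rule stationary_vector_pos[OF stochastic irreducible stationary])

text \<open>With the solution \<open>g\<close> of the Poisson equation, the centred sum up to time \<open>n\<close> is
\<open>g (X 0) - g (X n)\<close> plus a martingale with bounded increments. Hence it is of order $\sqrt n$ in mean.\<close>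

theorem ergodic_L1:
  "(\<lambda>n. \<integral>\<omega>. \<bar>(\<Sum>m<n. f (X m \<omega>)) / real n - (\<Sum>i\<in>UNIV. p $ i * f i)\<bar> \<partial>M) \<longlonglongrightarrow> 0"
proof -
  let ?\<mu> = "\<Sum>i\<in>UNIV. p $ i * f i"
  obtain g where g: "\<And>i. f i - ?\<mu> = g i - (\<Sum>j\<in>UNIV. P $ i $ j * g j)"
    using Poisson_equation[OF stochastic irreducible stationary] by blast
  define c where "c i j = g j - (\<Sum>l\<in>UNIV. P $ i $ l * g l)" for i j
  define D where "D = (\<Sum>i\<in>UNIV. \<bar>g i\<bar>)"
  have mart: "(\<Sum>j\<in>UNIV. P $ i $ j * c i j) = 0" for i
    using P_row_sum[of i] by (simp add: c_def right_diff_distrib sum_subtractf flip: sum_distrib_right)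
  obtain C where C: "\<And>i j. \<bar>c i j\<bar> \<le> C"
    using finite_type_bounded2 by blast
  have D: "\<bar>g i\<bar> \<le> D" for i
    unfolding D_def by (rule member_le_sum) auto
  have tele: "(\<Sum>m<n. f (X m \<omega>)) - real n * ?\<mu> =
      g (X 0 \<omega>) - g (X n \<omega>) + additive_functional c n \<omega>" for n \<omega>
  proof (induction n)
    case (Suc n)
    then show ?case
      using g[of "X n \<omega>"] by (simp add: additive_functional_def c_def algebra_simps)
  qed (simp add: additive_functional_def)
  have bound: "(\<integral>\<omega>. \<bar>(\<Sum>m<n. f (X m \<omega>)) / real n - ?\<mu>\<bar> \<partial>M) \<le>
      (2 * D + sqrt (real n) * C) / real n" if "0 < n" for n
  proof -
    have intS: "integrable M (\<lambda>\<omega>. \<bar>additive_functional c n \<omega>\<bar>)"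
    proof -
      have "integrable M (\<lambda>\<omega>. (\<lambda>x. \<bar>\<Sum>m<n. c (x m) (x (Suc m))\<bar>) (trajectory \<omega>))"
        by (intro integrable_prefix[where n=n] depends_on_prefixI arg_cong[where f=abs] sum.cong) auto
      then show ?thesis by (simp add: trajectory_def additive_functional_def)
    qed
    have intf: "integrable M (\<lambda>\<omega>. \<bar>(\<Sum>m<n. f (X m \<omega>)) / real n - ?\<mu>\<bar>)"
    proof -
      have "integrable M (\<lambda>\<omega>. (\<lambda>x. \<bar>(\<Sum>m<n. f (x m)) / real n - ?\<mu>\<bar>) (trajectory \<omega>))"
        by (intro integrable_prefix[where n=n] depends_on_prefixI) auto
      then show ?thesis by (simp add: trajectory_def)
    qed
    have "(\<integral>\<omega>. \<bar>(\<Sum>m<n. f (X m \<omega>)) / real n - ?\<mu>\<bar> \<partial>M) \<le>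
        (\<integral>\<omega>. (2 * D + \<bar>additive_functional c n \<omega>\<bar>) / real n \<partial>M)"
    proof (rule integral_mono)
      fix \<omega>
      have "\<bar>(\<Sum>m<n. f (X m \<omega>)) - real n * ?\<mu>\<bar> \<le> 2 * D + \<bar>additive_functional c n \<omega>\<bar>"
        unfolding tele using D[of "X 0 \<omega>"] D[of "X n \<omega>"] by linarith
      then have "\<bar>(\<Sum>m<n. f (X m \<omega>)) - real n * ?\<mu>\<bar> / real n \<le>
          (2 * D + \<bar>additive_functional c n \<omega>\<bar>) / real n"
        by (rule divide_right_mono) simp
      moreover have "\<bar>(\<Sum>m<n. f (X m \<omega>)) / real n - ?\<mu>\<bar> =
          \<bar>(\<Sum>m<n. f (X m \<omega>)) - real n * ?\<mu>\<bar> / real n"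
      proof -
        have "(\<Sum>m<n. f (X m \<omega>)) / real n - ?\<mu> = ((\<Sum>m<n. f (X m \<omega>)) - real n * ?\<mu>) / real n"
          using that by (simp add: diff_divide_distrib)
        then show ?thesis by (simp only: abs_divide abs_of_nat)
      qed
      ultimately show "\<bar>(\<Sum>m<n. f (X m \<omega>)) / real n - ?\<mu>\<bar> \<le>
          (2 * D + \<bar>additive_functional c n \<omega>\<bar>) / real n"
        by simp
    qed (use intf intS in auto)
    also have "\<dots> = (2 * D + (\<integral>\<omega>. \<bar>additive_functional c n \<omega>\<bar> \<partial>M)) / real n"
      using intS by (simp add: prob_space)
    also have "\<dots> \<le> (2 * D + sqrt (real n) * C) / real n"
      using martingale_first_moment[OF mart C] by (intro divide_right_mono add_left_mono) auto
    finally show ?thesis .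
  qed
  show ?thesis
  proof (rule tendsto_sandwich)
    show "\<forall>\<^sub>F n in sequentially.
        0 \<le> (\<integral>\<omega>. \<bar>(\<Sum>m<n. f (X m \<omega>)) / real n - ?\<mu>\<bar> \<partial>M)"
      by (intro always_eventually allI integral_nonneg_AE AE_I2 abs_ge_zero)
    show "\<forall>\<^sub>F n in sequentially. (\<integral>\<omega>. \<bar>(\<Sum>m<n. f (X m \<omega>)) / real n - ?\<mu>\<bar> \<partial>M) \<le>
        (2 * D + sqrt (real n) * C) / real n"
      using eventually_gt_at_top[of 0] by eventually_elim (rule bound)
    show "(\<lambda>n. (2 * D + sqrt (real n) * C) / real n) \<longlonglongrightarrow> 0"
      by real_asymp
  qed simp
qed

end

section \<open>The central limit theorem for martingale additive functionals\<close>

lemma abs_exp_diff_le: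
  fixes a b :: real
  assumes "a \<le> V" "b \<le> V"
  shows "\<bar>exp a - exp b\<bar> \<le> exp V * \<bar>a - b\<bar>"
proof -
  have *: "exp x - exp y \<le> exp V * (x - y)" if "y \<le> x" "x \<le> V" for x y :: real
  proof -
    have "exp x - exp y = exp x * (1 - exp (y - x))"
      by (simp add: right_diff_distrib flip: exp_add)
    also have "1 - exp (y - x) \<le> x - y"
      using exp_ge_add_one_self[of "y - x"] by linarith
    then have "exp x * (1 - exp (y - x)) \<le> exp x * (x - y)"
      by (rule mult_left_mono) simp
    also have "\<dots> \<le> exp V * (x - y)"
      using that by (intro mult_right_mono) auto
    finally show ?thesis .
  qed
  show ?thesis
  proof (cases "a \<le> b")
    case True
    then have "exp a \<le> exp b" by simp
    then show ?thesis using *[of a b] assms True by simp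
  next
    case False
    then have "exp b \<le> exp a" by simp
    then show ?thesis using *[of b a] assms False by simp
  qed
qed

lemma iexp_second_order: "cmod (iexp x - (1 + \<i> * of_real x - of_real (x\<^sup>2 / 2))) \<le> \<bar>x\<bar> ^ 3 / 6"
proof -
  have "(\<Sum>k\<le>2. (\<i> * of_real x) ^ k / fact k) = 1 + \<i> * of_real x - of_real (x\<^sup>2 / 2)"
  proof -
    have "{..2::nat} = {0, 1, 2}" by auto
    moreover have "(\<i> * of_real x)\<^sup>2 = - of_real (x\<^sup>2)"
      by (simp add: power_mult_distrib)
    ultimately show ?thesis by simp
  qed
  then show ?thesis
    using iexp_approx1[of x 2] by (simp add: fact_reduce numeral_3_eq_3)
qed

text \<open>The characteristic function of a centred increment of variance \<open>v\<close> at scale $n^{-1/2}$ is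
$e^{-v/2n}$ up to an error that stays negligible after \<open>n\<close> steps. Third moments are available because the increments take
finitely many values.\<close>

lemma one_step_char_expansion:
  fixes q c :: "'s::finite \<Rightarrow> real"
  assumes q: "\<And>j. 0 \<le> q j" "(\<Sum>j\<in>UNIV. q j) = 1" and mean: "(\<Sum>j\<in>UNIV. q j * c j) = 0"
  defines "v \<equiv> \<Sum>j\<in>UNIV. q j * (c j)\<^sup>2"
  shows "(\<lambda>n. real n * cmod (of_real (exp (v / (2 * real n))) *
    (\<Sum>j\<in>UNIV. of_real (q j) * iexp (c j / sqrt (real n))) - 1)) \<longlonglongrightarrow> 0"
proof -
  define B where "B = (\<Sum>j\<in>UNIV. q j * \<bar>c j\<bar> ^ 3) / 6"
  let ?y = "\<lambda>n. v / (2 * real n)"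
  let ?\<Phi> = "\<lambda>n. \<Sum>j\<in>UNIV. of_real (q j) * iexp (c j / sqrt (real n))"
  have \<Phi>: "cmod (?\<Phi> n - of_real (1 - ?y n)) \<le> B / sqrt (real n) ^ 3" if "0 < n" for n
  proof -
    let ?x = "\<lambda>j. c j / sqrt (real n)"
    have 1: "(\<Sum>j\<in>UNIV. q j * ?x j) = 0"
      using mean by (simp flip: sum_divide_distrib)
    have 2: "(\<Sum>j\<in>UNIV. q j * ((?x j)\<^sup>2 / 2)) = ?y n"
      using that by (simp add: v_def power_divide sum_divide_distrib mult.commute)
    have "(\<Sum>j\<in>UNIV. of_real (q j) * (1 + \<i> * of_real (?x j) - of_real ((?x j)\<^sup>2 / 2))) =
        of_real (\<Sum>j\<in>UNIV. q j) + \<i> * of_real (\<Sum>j\<in>UNIV. q j * ?x j) -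
        of_real (\<Sum>j\<in>UNIV. q j * ((?x j)\<^sup>2 / 2))"
      by (simp add: sum.distrib sum_subtractf algebra_simps sum_distrib_left)
    also have "\<dots> = of_real (1 - ?y n)"
      unfolding 1 2 q(2) by simp
    finally have "?\<Phi> n - of_real (1 - ?y n) = (\<Sum>j\<in>UNIV. of_real (q j) *
        (iexp (?x j) - (1 + \<i> * of_real (?x j) - of_real ((?x j)\<^sup>2 / 2))))"
      by (simp add: right_diff_distrib sum_subtractf)
    also have "cmod \<dots> \<le> (\<Sum>j\<in>UNIV. q j * (\<bar>?x j\<bar> ^ 3 / 6))"
    proof (intro sum_norm_le)
      fix j
      have "cmod (of_real (q j) * (iexp (?x j) - (1 + \<i> * of_real (?x j) - of_real ((?x j)\<^sup>2 / 2)))) =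
          q j * cmod (iexp (?x j) - (1 + \<i> * of_real (?x j) - of_real ((?x j)\<^sup>2 / 2)))"
        using q(1)[of j] by (simp only: norm_mult norm_of_real abs_of_nonneg)
      also have "\<dots> \<le> q j * (\<bar>?x j\<bar> ^ 3 / 6)"
        by (intro mult_left_mono iexp_second_order q)
      finally show "cmod (of_real (q j) *
          (iexp (?x j) - (1 + \<i> * of_real (?x j) - of_real ((?x j)\<^sup>2 / 2)))) \<le> q j * (\<bar>?x j\<bar> ^ 3 / 6)" .
    qed
    also have "\<dots> = B / sqrt (real n) ^ 3"
      by (simp add: B_def power_divide sum_divide_distrib mult_ac)
    finally show ?thesis .
  qed
  let ?u = "\<lambda>n. real n * (exp (?y n) * (B / sqrt (real n) ^ 3)) + real n * \<bar>exp (?y n) * (1 - ?y n) - 1\<bar>"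
  have bound: "real n * cmod (of_real (exp (?y n)) * ?\<Phi> n - 1) \<le> ?u n" if "0 < n" for n
  proof -
    have "of_real (exp (?y n)) * ?\<Phi> n - 1 =
        of_real (exp (?y n)) * (?\<Phi> n - of_real (1 - ?y n)) + of_real (exp (?y n) * (1 - ?y n) - 1)"
      by (simp add: algebra_simps)
    also have "cmod \<dots> \<le> exp (?y n) * cmod (?\<Phi> n - of_real (1 - ?y n)) + \<bar>exp (?y n) * (1 - ?y n) - 1\<bar>"
      by (rule order_trans[OF norm_triangle_ineq])
        (simp only: norm_mult norm_of_real abs_exp_cancel order_refl)
    also have "\<dots> \<le> exp (?y n) * (B / sqrt (real n) ^ 3) + \<bar>exp (?y n) * (1 - ?y n) - 1\<bar>"
      using \<Phi>[OF that] by (intro add_right_mono mult_left_mono) auto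
    finally show ?thesis
      unfolding distrib_left[symmetric] by (rule mult_left_mono) simp
  qed
  have "(\<lambda>n. real n * (exp (?y n) * (B / sqrt (real n) ^ 3))) \<longlonglongrightarrow> 0"
    by real_asymp
  moreover have "(\<lambda>n. real n * (exp (?y n) * (1 - ?y n) - 1)) \<longlonglongrightarrow> 0"
    by real_asymp
  then have "(\<lambda>n. real n * \<bar>exp (?y n) * (1 - ?y n) - 1\<bar>) \<longlonglongrightarrow> 0"
    using tendsto_rabs_zero by (fastforce simp: abs_mult)
  ultimately have u: "?u \<longlonglongrightarrow> 0"
    using tendsto_add_zero by blast
  show ?thesis
  proof (rule tendsto_sandwich[OF _ _ tendsto_const u])
    show "\<forall>\<^sub>F n in sequentially. real n * cmod (of_real (exp (?y n)) * ?\<Phi> n - 1) \<le> ?u n"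
      using eventually_gt_at_top[of 0] by eventually_elim (rule bound)
  qed (intro always_eventually allI mult_nonneg_nonneg norm_ge_zero of_nat_0_le_iff)
qed

context irreducible_markov_chain
begin

text \<open>Multiply the partial characteristic function by $\exp(\frac1{2n}\sum_{m<k} v(X_m))$, which compensates
the expected decrease in each step. The expectation of the product \<open>Q n k\<close> changes by $o(1/n)$ per step, so
it is still close to 1 at \<open>k = n\<close>. By the ergodic theorem the compensator at that time is close to the
constant $e^{\tau/2}$, which can then be taken out of the expectation.\<close>

theorem martingale_clt:
  assumes mart: "\<And>i. (\<Sum>j\<in>UNIV. P $ i $ j * c i j) = 0"
  shows "(\<lambda>n. \<integral>\<omega>. iexp (additive_functional c n \<omega> / sqrt (real n)) \<partial>M) \<longlonglongrightarrow>
    of_real (exp (- (\<Sum>i\<in>UNIV. p $ i * (\<Sum>j\<in>UNIV. P $ i $ j * (c i j)\<^sup>2)) / 2))"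
proof -
  \<comment> \<open>\<open>\<tau>\<close> is the stationary mean of the one-step variance \<open>v\<close>, \<open>A n k\<close> the exponent of the compensator
     after \<open>k\<close> steps, and \<open>e n i\<close> the factor by which a step from \<open>i\<close> changes the expectation.\<close>
  define v where "v i = (\<Sum>j\<in>UNIV. P $ i $ j * (c i j)\<^sup>2)" for i
  define \<tau> where "\<tau> = (\<Sum>i\<in>UNIV. p $ i * v i)"
  define V where "V = (\<Sum>i\<in>UNIV. v i)"
  have v_nonneg: "0 \<le> v i" for i
    unfolding v_def by (intro sum_nonneg mult_nonneg_nonneg P_nonneg zero_le_power2)
  have v_le: "v i \<le> V" for i
    unfolding V_def using v_nonneg by (intro member_le_sum) auto
  have "0 \<le> V"
    using v_nonneg v_le order_trans by blast
  define A where "A n k x = (\<Sum>m<k. v (x m)) / (2 * real n)" for n k and x :: "nat \<Rightarrow> 's"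
  define Q where "Q n k x = iexp ((\<Sum>m<k. c (x m) (x (Suc m))) / sqrt (real n)) * of_real (exp (A n k x))"
    for n k and x :: "nat \<Rightarrow> 's"
  define e where "e n i = of_real (exp (v i / (2 * real n))) *
    (\<Sum>j\<in>UNIV. of_real (P $ i $ j) * iexp (c i j / sqrt (real n)))" for n i
  define \<delta> where "\<delta> n = (\<Sum>i\<in>UNIV. cmod (e n i - 1))" for n
  have "(\<lambda>n. real n * cmod (e n i - 1)) \<longlonglongrightarrow> 0" for i
    unfolding e_def v_def by (rule one_step_char_expansion[OF P_nonneg P_row_sum mart])
  then have \<delta>: "(\<lambda>n. real n * \<delta> n) \<longlonglongrightarrow> 0"
    unfolding \<delta>_def sum_distrib_left by (intro tendsto_null_sum)
  have A_le: "A n k x \<le> V / 2" if "k \<le> n" for n k x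
  proof (cases "n = 0")
    case False
    have "(\<Sum>m<k. v (x m)) \<le> real k * V"
      using sum_bounded_above[of "{..<k}" "\<lambda>m. v (x m)" V] v_le by simp
    also have "\<dots> \<le> real n * V"
      using that \<open>0 \<le> V\<close> by (intro mult_right_mono) auto
    finally show ?thesis
      using False by (simp add: A_def field_simps)
  qed (use \<open>0 \<le> V\<close> in \<open>simp add: A_def\<close>)
  have norm_Q: "cmod (Q n k x) \<le> exp (V / 2)" if "k \<le> n" for n k x
    using A_le[OF that] by (simp add: Q_def norm_mult)
  have Q_dep: "depends_on_prefix k (Q n k)" for n k
  proof (rule depends_on_prefixI)
    fix x y :: "nat \<Rightarrow> 's" assume xy: "\<And>m. m \<le> k \<Longrightarrow> x m = y m"
    have "(\<Sum>m<k. c (x m) (x (Suc m))) = (\<Sum>m<k. c (y m) (y (Suc m)))"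
      "(\<Sum>m<k. v (x m)) = (\<Sum>m<k. v (y m))"
      using xy by (auto intro!: sum.cong)
    then show "Q n k x = Q n k y"
      by (simp only: Q_def A_def)
  qed
  have Q_int: "integrable M (\<lambda>\<omega>. Q n k (trajectory \<omega>))" for n k
    by (rule integrable_prefix[OF Q_dep])
  have step: "cmod ((\<integral>\<omega>. Q n (Suc k) (trajectory \<omega>) \<partial>M) - (\<integral>\<omega>. Q n k (trajectory \<omega>) \<partial>M)) \<le> exp (V / 2) * \<delta> n"
    if "k \<le> n" for n k
  proof -
    let ?h = "\<lambda>i j. of_real (exp (v i / (2 * real n))) * iexp (c i j / sqrt (real n))"
    have "Q n (Suc k) (trajectory \<omega>) = Q n k (trajectory \<omega>) * ?h (X k \<omega>) (X (Suc k) \<omega>)" for \<omega>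
      by (simp add: Q_def A_def trajectory_def add_divide_distrib distrib_left exp_add)
    then have "(\<integral>\<omega>. Q n (Suc k) (trajectory \<omega>) \<partial>M) =
        (\<integral>\<omega>. Q n k (trajectory \<omega>) * ?h (X k \<omega>) (X (Suc k) \<omega>) \<partial>M)"
      by presburger
    also have "\<dots> = (\<integral>\<omega>. Q n k (trajectory \<omega>) * (\<Sum>j\<in>UNIV. of_real (P $ X k \<omega> $ j) * ?h (X k \<omega>) j) \<partial>M)"
      by (rule markov_property_expectation[OF Q_dep])
    also have "\<dots> = (\<integral>\<omega>. Q n k (trajectory \<omega>) * e n (X k \<omega>) \<partial>M)"
      by (simp add: e_def sum_distrib_left mult_ac)
    finally have eq: "(\<integral>\<omega>. Q n (Suc k) (trajectory \<omega>) \<partial>M) = (\<integral>\<omega>. Q n k (trajectory \<omega>) * e n (X k \<omega>) \<partial>M)" .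
    have int: "integrable M (\<lambda>\<omega>. Q n k (trajectory \<omega>) * e n (X k \<omega>))"
    proof -
      have "depends_on_prefix k (\<lambda>x. Q n k x * e n (x k))"
        using Q_dep[of k n] by (simp add: depends_on_prefix_def)
      from integrable_prefix[OF this] show ?thesis
        by (simp add: trajectory_def)
    qed
    have "(\<integral>\<omega>. Q n (Suc k) (trajectory \<omega>) \<partial>M) - (\<integral>\<omega>. Q n k (trajectory \<omega>) \<partial>M) =
        (\<integral>\<omega>. Q n k (trajectory \<omega>) * e n (X k \<omega>) - Q n k (trajectory \<omega>) \<partial>M)"
      unfolding eq using int Q_int by simp
    also have "cmod \<dots> \<le> (\<integral>\<omega>. exp (V / 2) * \<delta> n \<partial>M)"
    proof (rule norm_integral_le)
      fix \<omega>
      have "cmod (e n (X k \<omega>) - 1) \<le> \<delta> n"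
        unfolding \<delta>_def by (rule member_le_sum) auto
      then have "cmod (Q n k (trajectory \<omega>)) * cmod (e n (X k \<omega>) - 1) \<le> exp (V / 2) * \<delta> n"
        using norm_Q[OF that] by (intro mult_mono) auto
      then show "cmod (Q n k (trajectory \<omega>) * e n (X k \<omega>) - Q n k (trajectory \<omega>)) \<le> exp (V / 2) * \<delta> n"
        by (simp add: right_diff_distrib flip: norm_mult)
    qed (use int Q_int in auto)
    also have "\<dots> = exp (V / 2) * \<delta> n"
      by (simp add: prob_space)
    finally show ?thesis .
  qed
  have EQ: "cmod ((\<integral>\<omega>. Q n k (trajectory \<omega>) \<partial>M) - 1) \<le> real k * (exp (V / 2) * \<delta> n)" if "k \<le> n" for n k
    using that
  proof (induction k)
    case 0
    show ?case by (simp add: Q_def A_def prob_space)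
  next
    case (Suc k)
    then show ?case
      using step[of k n]
        norm_triangle_ineq[of "(\<integral>\<omega>. Q n (Suc k) (trajectory \<omega>) \<partial>M) - (\<integral>\<omega>. Q n k (trajectory \<omega>) \<partial>M)"
          "(\<integral>\<omega>. Q n k (trajectory \<omega>) \<partial>M) - 1"]
      by (simp add: distrib_right)
  qed
  have "(\<lambda>n. (\<integral>\<omega>. Q n n (trajectory \<omega>) \<partial>M) - 1) \<longlonglongrightarrow> 0"
  proof (rule Lim_null_comparison)
    show "\<forall>\<^sub>F n in sequentially.
        cmod ((\<integral>\<omega>. Q n n (trajectory \<omega>) \<partial>M) - 1) \<le> exp (V / 2) * (real n * \<delta> n)"
      using EQ by (intro always_eventually allI) (simp add: mult.left_commute)
    show "(\<lambda>n. exp (V / 2) * (real n * \<delta> n)) \<longlonglongrightarrow> 0"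
      by (rule tendsto_mult_right_zero[OF \<delta>])
  qed
  define F where "F n = (\<integral>\<omega>. iexp (additive_functional c n \<omega> / sqrt (real n)) \<partial>M)" for n
  have S: "additive_functional c n \<omega> = (\<Sum>m<n. c (trajectory \<omega> m) (trajectory \<omega> (Suc m)))" for n \<omega>
    by (simp add: additive_functional_def trajectory_def)
  have \<tau>_le: "\<tau> / 2 \<le> V / 2"
  proof -
    have "\<tau> \<le> (\<Sum>i\<in>UNIV. p $ i * V)"
      unfolding \<tau>_def using v_le less_imp_le[OF p_pos] by (intro sum_mono mult_left_mono)
    also have "\<dots> = V"
      using stationary by (simp add: stationary_vector_def flip: sum_distrib_right)
    finally show ?thesis by simp
  qed
  let ?D = "\<lambda>n \<omega>. \<bar>(\<Sum>m<n. v (X m \<omega>)) / real n - \<tau>\<bar>"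
  have close: "cmod (F n * of_real (exp (\<tau> / 2)) - (\<integral>\<omega>. Q n n (trajectory \<omega>) \<partial>M)) \<le>
      exp (V / 2) / 2 * (\<integral>\<omega>. ?D n \<omega> \<partial>M)" for n
  proof -
    have intF: "integrable M (\<lambda>\<omega>. iexp (additive_functional c n \<omega> / sqrt (real n)))"
      by (rule integrable_iexp) measurable
    have intD: "integrable M (?D n)"
    proof -
      have "integrable M (\<lambda>\<omega>. (\<lambda>x. \<bar>(\<Sum>m<n. v (x m)) / real n - \<tau>\<bar>) (trajectory \<omega>))"
        by (intro integrable_prefix[where n=n] depends_on_prefixI) auto
      then show ?thesis by (simp add: trajectory_def)
    qed
    have "F n * of_real (exp (\<tau> / 2)) - (\<integral>\<omega>. Q n n (trajectory \<omega>) \<partial>M) =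
        (\<integral>\<omega>. iexp (additive_functional c n \<omega> / sqrt (real n)) * of_real (exp (\<tau> / 2)) -
          Q n n (trajectory \<omega>) \<partial>M)"
      unfolding F_def using intF Q_int[of n n] by simp
    also have "cmod \<dots> \<le> (\<integral>\<omega>. exp (V / 2) / 2 * ?D n \<omega> \<partial>M)"
    proof (rule norm_integral_le)
      fix \<omega>
      have "iexp (additive_functional c n \<omega> / sqrt (real n)) * of_real (exp (\<tau> / 2)) - Q n n (trajectory \<omega>) =
          iexp (additive_functional c n \<omega> / sqrt (real n)) *
          of_real (exp (\<tau> / 2) - exp (A n n (trajectory \<omega>)))"
        by (simp add: Q_def S right_diff_distrib)
      also have "cmod \<dots> = \<bar>exp (\<tau> / 2) - exp (A n n (trajectory \<omega>))\<bar>"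
        by (simp only: norm_mult norm_exp_i_times norm_of_real mult_1)
      also have "\<dots> \<le> exp (V / 2) * \<bar>\<tau> / 2 - A n n (trajectory \<omega>)\<bar>"
        by (rule abs_exp_diff_le[OF \<tau>_le A_le[OF order_refl]])
      also have "\<bar>\<tau> / 2 - A n n (trajectory \<omega>)\<bar> = ?D n \<omega> / 2"
        by (simp add: A_def trajectory_def field_simps abs_minus_commute)
      finally show "cmod (iexp (additive_functional c n \<omega> / sqrt (real n)) * of_real (exp (\<tau> / 2)) -
          Q n n (trajectory \<omega>)) \<le> exp (V / 2) / 2 * ?D n \<omega>"
        by simp
    qed (use intF intD Q_int[of n n] in auto)
    finally show ?thesis by simp
  qed
  have "(\<lambda>n. F n * of_real (exp (\<tau> / 2)) - (\<integral>\<omega>. Q n n (trajectory \<omega>) \<partial>M)) \<longlonglongrightarrow> 0"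
  proof (rule Lim_null_comparison)
    show "(\<lambda>n. exp (V / 2) / 2 * (\<integral>\<omega>. ?D n \<omega> \<partial>M)) \<longlonglongrightarrow> 0"
      unfolding \<tau>_def by (rule tendsto_mult_right_zero[OF ergodic_L1])
  qed (use close in simp)
  from tendsto_add[OF this \<open>(\<lambda>n. (\<integral>\<omega>. Q n n (trajectory \<omega>) \<partial>M) - 1) \<longlonglongrightarrow> 0\<close>]
  have "(\<lambda>n. F n * of_real (exp (\<tau> / 2)) - 1) \<longlonglongrightarrow> 0"
    by simp
  then have "(\<lambda>n. F n * of_real (exp (\<tau> / 2)) * of_real (exp (- \<tau> / 2))) \<longlonglongrightarrow>
      1 * of_real (exp (- \<tau> / 2))"
    by (intro tendsto_mult tendsto_const) (simp add: LIM_zero_iff)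
  moreover have "F n * of_real (exp (\<tau> / 2)) * of_real (exp (- \<tau> / 2)) = F n" for n
  proof -
    have "exp (\<tau> / 2) * exp (- \<tau> / 2) = 1"
      by (simp flip: exp_add)
    then show ?thesis
      by (simp only: mult.assoc of_real_mult[symmetric] of_real_1 mult_1_right)
  qed
  ultimately have "(\<lambda>n. F n) \<longlonglongrightarrow> of_real (exp (- \<tau> / 2))"
    by (simp only: mult_1)
  then show ?thesis
    unfolding F_def \<tau>_def v_def .
qed

end

section \<open>Gaussian random matrices\<close>

text \<open>The integral of a function that is not integrable is 0 by convention, so the prescribed means and
covariances of a Gaussian matrix carry information only once integrability is known.\<close>

lemma gaussian_rv_square_integrable:
  assumes M: "prob_space M" and Y: "gaussian_rv M Y"
  shows "integrable M Y" "integrable M (\<lambda>\<omega>. (Y \<omega>)\<^sup>2)"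
proof -
  interpret prob_space M by fact
  have [measurable]: "Y \<in> borel_measurable M"
    using Y by (simp add: gaussian_rv_def)
  obtain \<mu> \<sigma> where \<sigma>: "0 \<le> \<sigma>" and distr:
    "distr M borel Y = (if \<sigma> = 0 then return borel \<mu> else density lborel (normal_density \<mu> \<sigma>))"
    using Y by (auto simp: gaussian_rv_def)
  have int: "integrable (distr M borel Y) (\<lambda>x. (x - \<mu>) ^ k)" for k
  proof (cases "\<sigma> = 0")
    case True
    then show ?thesis
      unfolding distr by (auto simp: integrable_iff_bounded nn_integral_return)
  next
    case False
    then show ?thesis
      using \<sigma> integrable_normal_moment[of \<sigma> \<mu> k] unfolding distr
      by (simp add: integrable_density)
  qed
  have int': "integrable M (\<lambda>\<omega>. (Y \<omega> - \<mu>) ^ k)" for k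
    using int[of k] by (subst (asm) integrable_distr_eq) auto
  from int'[of 1] have "integrable M (\<lambda>\<omega>. (Y \<omega> - \<mu>) + \<mu>)"
    by (intro Bochner_Integration.integrable_add) auto
  then show "integrable M Y" by simp
  then have "integrable M (\<lambda>\<omega>. (Y \<omega> - \<mu>)\<^sup>2 + 2 * \<mu> * Y \<omega> - \<mu>\<^sup>2)"
    using int'[of 2] by auto
  then show "integrable M (\<lambda>\<omega>. (Y \<omega>)\<^sup>2)"
    by (simp add: power2_diff mult_ac)
qed

lemma char_centered_gaussian_rv:
  assumes M: "prob_space M" and Y: "gaussian_rv M Y" and mean: "(\<integral>\<omega>. Y \<omega> \<partial>M) = 0"
  shows "(\<integral>\<omega>. iexp (Y \<omega>) \<partial>M) = of_real (exp (- (\<integral>\<omega>. (Y \<omega>)\<^sup>2 \<partial>M) / 2))"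
proof -
  interpret prob_space M by fact
  have [measurable]: "Y \<in> borel_measurable M"
    using Y by (simp add: gaussian_rv_def)
  obtain \<mu> \<sigma> where \<sigma>: "0 \<le> \<sigma>" and distr:
    "distr M borel Y = (if \<sigma> = 0 then return borel \<mu> else density lborel (normal_density \<mu> \<sigma>))"
    using Y by (auto simp: gaussian_rv_def)
  show ?thesis
  proof (cases "\<sigma> = 0")
    case True
    have via: "(\<integral>\<omega>. f (Y \<omega>) \<partial>M) = f \<mu>" if [measurable]: "f \<in> borel_measurable borel"
      for f :: "real \<Rightarrow> 'b::{banach, second_countable_topology}"
    proof -
      have "(\<integral>\<omega>. f (Y \<omega>) \<partial>M) = (\<integral>x. f x \<partial>distr M borel Y)"
        by (rule integral_distr[symmetric]) measurable
      also have "\<dots> = f \<mu>"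
        using True by (simp add: distr integral_return)
      finally show ?thesis .
    qed
    have "\<mu> = 0"
      using via[of "\<lambda>x. x"] mean by simp
    then show ?thesis
      using via[of iexp] via[of "\<lambda>x. x\<^sup>2"] by simp
  next
    case False
    with \<sigma> have pos: "0 < \<sigma>" by simp
    have "distr M lborel Y = distr M borel Y"
      by (rule distr_cong) auto
    then have D: "distributed M lborel Y (normal_density \<mu> \<sigma>)"
      using False by (simp add: distributed_def distr)
    have "\<mu> = 0"
      using normal_distributed_expectation[OF pos D] mean by simp
    then have "(\<integral>\<omega>. (Y \<omega>)\<^sup>2 \<partial>M) = \<sigma>\<^sup>2"
      using normal_distributed_variance[OF pos D] mean by simp
    moreover have "(\<integral>\<omega>. iexp (Y \<omega>) \<partial>M) = of_real (exp (- \<sigma>\<^sup>2 / 2))"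
    proof -
      have "distributed M lborel (\<lambda>\<omega>. Y \<omega> / \<sigma>) std_normal_density"
        using D pos \<open>\<mu> = 0\<close> by (subst (asm) normal_standard_normal_convert) auto
      then have "std_normal_distribution = distr M lborel (\<lambda>\<omega>. Y \<omega> / \<sigma>)"
        by (simp add: distributed_def)
      then have "char std_normal_distribution \<sigma> = (\<integral>\<omega>. iexp (\<sigma> * (Y \<omega> / \<sigma>)) \<partial>M)"
        using pos by (simp add: char_def integral_distr)
      then show ?thesis
        using pos by (simp add: char_std_normal_distribution)
    qed
    ultimately show ?thesis by simp
  qed
qed

text \<open>The covariance couples entries of the same row only. Each row contributes the variance, under that
row of \<open>P\<close>, of the matching row of \<open>a\<close>, divided by the stationary weight.\<close>

lemma char_mle_limit_matrix:
  fixes W :: "'b \<Rightarrow> real^'s^'s"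
  assumes W: "mle_limit_matrix M W P p"
  shows "(\<integral>\<omega>. iexp (a \<bullet> W \<omega>) \<partial>M) = of_real (exp (- (\<Sum>i\<in>UNIV. inverse (p $ i) *
    ((\<Sum>j\<in>UNIV. P $ i $ j * (a $ i $ j)\<^sup>2) - (\<Sum>j\<in>UNIV. P $ i $ j * a $ i $ j)\<^sup>2)) / 2))"
proof -
  have M: "prob_space M" and gauss: "\<And>a. gaussian_rv M (\<lambda>\<omega>. \<Sum>i\<in>UNIV. \<Sum>j\<in>UNIV. a i j * W \<omega> $ i $ j)"
    and mean: "\<And>i j. (\<integral>\<omega>. W \<omega> $ i $ j \<partial>M) = 0"
    and cov: "\<And>i j k l. covariance M (\<lambda>\<omega>. W \<omega> $ i $ j) (\<lambda>\<omega>. W \<omega> $ k $ l) =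
        of_bool (i = k) * inverse (p $ i) * P $ i $ j * (of_bool (j = l) - P $ i $ l)"
    using W by (auto simp: mle_limit_matrix_def gaussian_matrix_def)
  interpret prob_space M by fact
  have inner: "a \<bullet> x = (\<Sum>i\<in>UNIV. \<Sum>j\<in>UNIV. a $ i $ j * x $ i $ j)" for x :: "real^'s^'s"
    by (simp add: inner_vec_def)
  have entry: "gaussian_rv M (\<lambda>\<omega>. W \<omega> $ i $ j)" for i j
  proof -
    have "(\<Sum>i'\<in>UNIV. \<Sum>j'\<in>UNIV. (if i' = i then if j' = j then 1 else 0 else 0) * x $ i' $ j') = x $ i $ j"
      for x :: "real^'s^'s"
    proof -
      have "(\<Sum>j'\<in>UNIV. (if i' = i then if j' = j then 1 else 0 else 0) * x $ i' $ j') =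
          (\<Sum>j'\<in>UNIV. if j' = j then if i' = i then x $ i $ j else 0 else 0)" for i'
        by (intro sum.cong) auto
      then show ?thesis by simp
    qed
    then show ?thesis
      using gauss[of "\<lambda>i' j'. if i' = i then if j' = j then 1 else 0 else 0"] by simp
  qed
  note int1 = gaussian_rv_square_integrable(1)[OF M entry]
  note int2 = gaussian_rv_square_integrable(2)[OF M entry]
  have int12: "integrable M (\<lambda>\<omega>. W \<omega> $ i $ j * W \<omega> $ k $ l)" for i j k l
  proof (rule Bochner_Integration.integrable_bound)
    show "integrable M (\<lambda>\<omega>. (W \<omega> $ i $ j)\<^sup>2 + (W \<omega> $ k $ l)\<^sup>2)"
      by (intro Bochner_Integration.integrable_add int2)
    show "(\<lambda>\<omega>. W \<omega> $ i $ j * W \<omega> $ k $ l) \<in> borel_measurable M"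
      by (intro borel_measurable_times borel_measurable_integrable int1)
    have "\<bar>x * y\<bar> \<le> x\<^sup>2 + y\<^sup>2" for x y :: real
    proof -
      have "2 * \<bar>x\<bar> * \<bar>y\<bar> \<le> \<bar>x\<bar>\<^sup>2 + \<bar>y\<bar>\<^sup>2"
        by (rule sum_squares_bound)
      moreover have "0 \<le> \<bar>x\<bar> * \<bar>y\<bar>" by simp
      ultimately show ?thesis
        unfolding abs_mult power2_abs by linarith
    qed
    then show "AE \<omega> in M. norm (W \<omega> $ i $ j * W \<omega> $ k $ l) \<le> norm ((W \<omega> $ i $ j)\<^sup>2 + (W \<omega> $ k $ l)\<^sup>2)"
      by simp
  qed
  have mean_a: "(\<integral>\<omega>. a \<bullet> W \<omega> \<partial>M) = 0"
    unfolding inner using int1 mean by simp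
  have "(\<integral>\<omega>. (a \<bullet> W \<omega>)\<^sup>2 \<partial>M) =
      (\<integral>\<omega>. (\<Sum>i\<in>UNIV. \<Sum>j\<in>UNIV. \<Sum>k\<in>UNIV. \<Sum>l\<in>UNIV.
        (a $ i $ j * a $ k $ l) * (W \<omega> $ i $ j * W \<omega> $ k $ l)) \<partial>M)"
    unfolding inner power2_eq_square sum_distrib_right sum_distrib_left
    by (simp only: mult_ac)
  also have "\<dots> = (\<Sum>i\<in>UNIV. \<Sum>j\<in>UNIV. \<Sum>k\<in>UNIV. \<Sum>l\<in>UNIV.
      (a $ i $ j * a $ k $ l) * covariance M (\<lambda>\<omega>. W \<omega> $ i $ j) (\<lambda>\<omega>. W \<omega> $ k $ l))"
    using int12 by (simp add: covariance_def mean)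
  also have "\<dots> = (\<Sum>i\<in>UNIV. inverse (p $ i) *
      ((\<Sum>j\<in>UNIV. P $ i $ j * (a $ i $ j)\<^sup>2) - (\<Sum>j\<in>UNIV. P $ i $ j * a $ i $ j)\<^sup>2))"
  proof (rule sum.cong[OF refl])
    fix i
    let ?m = "\<Sum>l\<in>UNIV. P $ i $ l * a $ i $ l"
    have "(\<Sum>j\<in>UNIV. \<Sum>k\<in>UNIV. \<Sum>l\<in>UNIV.
        (a $ i $ j * a $ k $ l) * covariance M (\<lambda>\<omega>. W \<omega> $ i $ j) (\<lambda>\<omega>. W \<omega> $ k $ l)) =
        (\<Sum>j\<in>UNIV. \<Sum>k\<in>UNIV. if k = i then inverse (p $ i) * (P $ i $ j * a $ i $ j * (a $ i $ j - ?m)) else 0)"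
    proof (intro sum.cong refl)
      fix j k
      show "(\<Sum>l\<in>UNIV. (a $ i $ j * a $ k $ l) * covariance M (\<lambda>\<omega>. W \<omega> $ i $ j) (\<lambda>\<omega>. W \<omega> $ k $ l)) =
          (if k = i then inverse (p $ i) * (P $ i $ j * a $ i $ j * (a $ i $ j - ?m)) else 0)"
      proof (cases "k = i")
        case True
        have "(\<Sum>l\<in>UNIV. (a $ i $ j * a $ i $ l) * covariance M (\<lambda>\<omega>. W \<omega> $ i $ j) (\<lambda>\<omega>. W \<omega> $ i $ l)) =
            (\<Sum>l\<in>UNIV. inverse (p $ i) * P $ i $ j * a $ i $ j *
              ((if l = j then a $ i $ j else 0) - P $ i $ l * a $ i $ l))"
          by (intro sum.cong refl) (auto simp: cov algebra_simps)
        also have "\<dots> = inverse (p $ i) * P $ i $ j * a $ i $ j * (a $ i $ j - ?m)"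
          by (simp add: sum_subtractf flip: sum_distrib_left)
        finally show ?thesis using True by (simp add: mult_ac)
      qed (simp add: cov)
    qed
    also have "\<dots> = (\<Sum>j\<in>UNIV. inverse (p $ i) * (P $ i $ j * (a $ i $ j)\<^sup>2 - P $ i $ j * a $ i $ j * ?m))"
      by (simp add: power2_eq_square algebra_simps)
    also have "\<dots> = inverse (p $ i) * ((\<Sum>j\<in>UNIV. P $ i $ j * (a $ i $ j)\<^sup>2) - ?m * ?m)"
      by (simp only: sum_distrib_left[symmetric] sum_subtractf sum_distrib_right[symmetric])
    finally show "(\<Sum>j\<in>UNIV. \<Sum>k\<in>UNIV. \<Sum>l\<in>UNIV.
        (a $ i $ j * a $ k $ l) * covariance M (\<lambda>\<omega>. W \<omega> $ i $ j) (\<lambda>\<omega>. W \<omega> $ k $ l)) =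
        inverse (p $ i) * ((\<Sum>j\<in>UNIV. P $ i $ j * (a $ i $ j)\<^sup>2) - ?m\<^sup>2)"
      by (simp add: power2_eq_square)
  qed
  finally have var: "(\<integral>\<omega>. (a \<bullet> W \<omega>)\<^sup>2 \<partial>M) = \<dots>" .
  have "gaussian_rv M (\<lambda>\<omega>. a \<bullet> W \<omega>)"
    unfolding inner by (rule gauss)
  from char_centered_gaussian_rv[OF M this mean_a] show ?thesis
    unfolding var .
qed

section \<open>Asymptotic normality of the empirical transition matrix\<close>

lemma real_transition_count:
  "real (transition_count X n i j \<omega>) = (\<Sum>m<n. of_bool (X m \<omega> = i \<and> X (Suc m) \<omega> = j))"
proof -
  have "{m. m < n \<and> X m \<omega> = i \<and> X (Suc m) \<omega> = j} = {m \<in> {..<n}. X m \<omega> = i \<and> X (Suc m) \<omega> = j}"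
    by auto
  then show ?thesis
    by (simp add: transition_count_def Int_def)
qed

lemma real_visit_count:
  fixes X :: "nat \<Rightarrow> 'a \<Rightarrow> 's::finite"
  shows "real (visit_count X n i \<omega>) = (\<Sum>m<n. of_bool (X m \<omega> = i))"
proof -
  have "real (visit_count X n i \<omega>) = (\<Sum>m<n. \<Sum>j\<in>UNIV. of_bool (X m \<omega> = i \<and> X (Suc m) \<omega> = j))"
    unfolding visit_count_def of_nat_sum real_transition_count by (rule sum.swap)
  moreover have "(\<Sum>j\<in>UNIV. of_bool (X m \<omega> = i \<and> X (Suc m) \<omega> = j)) = (of_bool (X m \<omega> = i) :: real)" for m
    by (cases "X m \<omega> = i") (auto simp: of_bool_def)
  ultimately show ?thesis by simp
qed

context finite_markov_chain
begin

text \<open>At each time the estimator takes finitely many values, so every function of it is measurable. This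
covers plug-in quantities with arbitrary values where the defining inverse does not exist.\<close>

lemma measurable_mle:
  fixes F :: "real^'s^'s \<Rightarrow> 'c::{banach, second_countable_topology}"
  shows "(\<lambda>\<omega>. F (transition_mle X n \<omega>)) \<in> borel_measurable M"
proof -
  let ?G = "\<lambda>x. F (transition_mle (\<lambda>m x. x m) n x)"
  have "depends_on_prefix n ?G"
  proof (rule depends_on_prefixI)
    fix x y :: "nat \<Rightarrow> 's" assume xy: "\<And>m. m \<le> n \<Longrightarrow> x m = y m"
    have count: "transition_count (\<lambda>m x. x m) n i j x = transition_count (\<lambda>m x. x m) n i j y" for i j
      unfolding transition_count_def using xy by (intro arg_cong[where f=card]) auto
    show "?G x = ?G y"
      by (simp only: transition_mle_def visit_count_def count)
  qed
  from integrable_prefix[OF this]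
  have "(\<lambda>\<omega>. ?G (trajectory \<omega>)) \<in> borel_measurable M"
    by (rule borel_measurable_integrable)
  moreover have "transition_mle (\<lambda>m x. x m) n (trajectory \<omega>) = transition_mle X n \<omega>" for \<omega>
    by (simp only: transition_mle_def visit_count_def transition_count_def trajectory_def)
  ultimately show ?thesis by simp
qed

end

context irreducible_markov_chain
begin

lemma visit_frequency_converges_in_probability:
  assumes "0 < \<delta>"
  shows "(\<lambda>n. prob {\<omega> \<in> space M. \<delta> \<le> \<bar>real (visit_count X n i \<omega>) / real n - p $ i\<bar>}) \<longlonglongrightarrow> 0"
proof -
  have [measurable]: "(\<lambda>\<omega>. real (visit_count X n i \<omega>)) \<in> borel_measurable M" for n
    unfolding real_visit_count by measurable
  let ?u = "\<lambda>n \<omega>. \<bar>real (visit_count X n i \<omega>) / real n - p $ i\<bar>"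
  have int: "integrable M (?u n)" for n
  proof -
    have "integrable M (\<lambda>\<omega>. (\<lambda>x. \<bar>(\<Sum>m<n. of_bool (x m = i)) / real n - p $ i\<bar>) (trajectory \<omega>))"
      by (intro integrable_prefix[where n=n] depends_on_prefixI) auto
    then show ?thesis by (simp add: trajectory_def real_visit_count)
  qed
  have "(\<lambda>n. (\<integral>\<omega>. ?u n \<omega> \<partial>M)) \<longlonglongrightarrow> 0"
    using ergodic_L1[of "\<lambda>l. of_bool (l = i)"] by (simp add: real_visit_count)
  then have lim: "(\<lambda>n. (\<integral>\<omega>. ?u n \<omega> \<partial>M) / \<delta>) \<longlonglongrightarrow> 0"
    using assms tendsto_divide_zero by blast
  show ?thesis
  proof (rule tendsto_sandwich[OF _ _ tendsto_const lim])
    show "\<forall>\<^sub>F n in sequentially. prob {\<omega> \<in> space M. \<delta> \<le> ?u n \<omega>} \<le> (\<integral>\<omega>. ?u n \<omega> \<partial>M) / \<delta>"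
      using assms int by (intro always_eventually allI integral_Markov_inequality_measure[of _ _ "{}"]) auto
  qed simp
qed

text \<open>The first-order part of the rescaled estimation error: the random row counts in the denominators of
the estimator are replaced by their limits. Unlike for the error itself, every linear functional
of it is a martingale additive functional of the chain, divided by $\sqrt n$.\<close>

definition score :: "nat \<Rightarrow> 'a \<Rightarrow> real^'s^'s" where
  "score n \<omega> = (\<chi> i j. (real (transition_count X n i j \<omega>) - P $ i $ j * real (visit_count X n i \<omega>)) /
     (sqrt (real n) * p $ i))"

lemma measurable_score[measurable]: "score n \<in> borel_measurable M"
proof -
  let ?G = "\<lambda>x. \<chi> i j. ((\<Sum>m<n. of_bool (x m = i \<and> x (Suc m) = j)) -
    P $ i $ j * (\<Sum>m<n. of_bool (x m = i))) / (sqrt (real n) * p $ i) :: real^'s^'s"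
  have "depends_on_prefix n ?G"
  proof (rule depends_on_prefixI)
    fix x y :: "nat \<Rightarrow> 's" assume xy: "\<And>m. m \<le> n \<Longrightarrow> x m = y m"
    have "(\<Sum>m<n. of_bool (x m = i \<and> x (Suc m) = j)) = (\<Sum>m<n. of_bool (y m = i \<and> y (Suc m) = j) :: real)"
      "(\<Sum>m<n. of_bool (x m = i)) = (\<Sum>m<n. of_bool (y m = i) :: real)" for i j
      using xy by (auto intro!: sum.cong)
    then show "?G x = ?G y" by simp
  qed
  from integrable_prefix[OF this] show ?thesis
    by (simp add: trajectory_def score_def[abs_def] real_transition_count real_visit_count)
qed

text \<open>The coefficient matrix \<open>a\<close> is centred row by row, which is what makes the increments have conditional
mean 0.\<close>

definition score_increment :: "real^'s^'s \<Rightarrow> 's \<Rightarrow> 's \<Rightarrow> real" where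
  "score_increment a i j = (a $ i $ j - (\<Sum>l\<in>UNIV. P $ i $ l * a $ i $ l)) / p $ i"

lemma score_increment_mean: "(\<Sum>j\<in>UNIV. P $ i $ j * score_increment a i j) = 0"
proof -
  have "(\<Sum>j\<in>UNIV. P $ i $ j * score_increment a i j) =
      (\<Sum>j\<in>UNIV. P $ i $ j * a $ i $ j - P $ i $ j * (\<Sum>l\<in>UNIV. P $ i $ l * a $ i $ l)) / p $ i"
    by (simp add: score_increment_def right_diff_distrib sum_divide_distrib)
  also have "\<dots> = 0"
    by (simp add: sum_subtractf P_row_sum flip: sum_distrib_right)
  finally show ?thesis .
qed

text \<open>The stationary variance of the increment is exactly the variance of \<open>a \<bullet> W\<close> in the limit law.\<close>

lemma score_increment_variance:
  "p $ i * (\<Sum>j\<in>UNIV. P $ i $ j * (score_increment a i j)\<^sup>2) = inverse (p $ i) *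
    ((\<Sum>j\<in>UNIV. P $ i $ j * (a $ i $ j)\<^sup>2) - (\<Sum>j\<in>UNIV. P $ i $ j * a $ i $ j)\<^sup>2)"
proof -
  let ?m = "\<Sum>l\<in>UNIV. P $ i $ l * a $ i $ l"
  have "(\<Sum>j\<in>UNIV. P $ i $ j * (score_increment a i j)\<^sup>2) =
      (\<Sum>j\<in>UNIV. P $ i $ j * (a $ i $ j)\<^sup>2 - 2 * ?m * (P $ i $ j * a $ i $ j) + P $ i $ j * ?m\<^sup>2) / (p $ i)\<^sup>2"
    by (simp add: score_increment_def power_divide power2_diff sum_divide_distrib algebra_simps)
  also have "\<dots> = ((\<Sum>j\<in>UNIV. P $ i $ j * (a $ i $ j)\<^sup>2) - 2 * ?m * ?m + 1 * ?m\<^sup>2) / (p $ i)\<^sup>2"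
    by (simp only: sum.distrib sum_subtractf sum_distrib_left[symmetric] sum_distrib_right[symmetric] P_row_sum)
  finally show ?thesis
    using p_pos[of i] by (simp add: power2_eq_square field_simps)
qed

lemma inner_score:
  "a \<bullet> score n \<omega> = additive_functional (score_increment a) n \<omega> / sqrt (real n)"
proof -
  define t where "t m i j = of_bool (X m \<omega> = i \<and> X (Suc m) \<omega> = j) - P $ i $ j * of_bool (X m \<omega> = i)" for m i j
  have step: "(\<Sum>i\<in>UNIV. \<Sum>j\<in>UNIV. a $ i $ j * t m i j / p $ i) = score_increment a (X m \<omega>) (X (Suc m) \<omega>)" for m
  proof -
    have "(\<Sum>j\<in>UNIV. a $ i $ j * t m i j / p $ i) =
        (if i = X m \<omega> then score_increment a (X m \<omega>) (X (Suc m) \<omega>) else 0)" for i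
    proof (cases "i = X m \<omega>")
      case True
      have "(\<Sum>j\<in>UNIV. a $ i $ j * t m i j) =
          (\<Sum>j\<in>UNIV. (if j = X (Suc m) \<omega> then a $ i $ j else 0) - P $ i $ j * a $ i $ j)"
        using True by (intro sum.cong) (auto simp: t_def algebra_simps)
      also have "\<dots> = a $ i $ X (Suc m) \<omega> - (\<Sum>j\<in>UNIV. P $ i $ j * a $ i $ j)"
        by (simp add: sum_subtractf)
      finally show ?thesis
        using True by (simp add: score_increment_def flip: sum_divide_distrib)
    qed (auto simp: t_def)
    then show ?thesis by simp
  qed
  have "score n \<omega> $ i $ j = (\<Sum>m<n. t m i j) / (sqrt (real n) * p $ i)" for i j
    unfolding score_def real_transition_count real_visit_count t_def sum_subtractf sum_distrib_left
    by simp
  then have "a $ i $ j * score n \<omega> $ i $ j = (\<Sum>m<n. a $ i $ j * t m i j / p $ i) / sqrt (real n)" for i j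
    by (simp add: sum_distrib_left sum_divide_distrib mult_ac)
  then have "a \<bullet> score n \<omega> = (\<Sum>i\<in>UNIV. \<Sum>j\<in>UNIV. \<Sum>m<n. a $ i $ j * t m i j / p $ i) / sqrt (real n)"
    by (simp add: inner_vec_def sum_divide_distrib)
  also have "(\<Sum>i\<in>UNIV. \<Sum>j\<in>UNIV. \<Sum>m<n. a $ i $ j * t m i j / p $ i) =
      (\<Sum>i\<in>UNIV. \<Sum>m<n. \<Sum>j\<in>UNIV. a $ i $ j * t m i j / p $ i)"
    by (intro sum.cong refl sum.swap)
  also have "\<dots> = (\<Sum>m<n. \<Sum>i\<in>UNIV. \<Sum>j\<in>UNIV. a $ i $ j * t m i j / p $ i)"
    by (rule sum.swap)
  finally show ?thesis
    unfolding step additive_functional_def .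
qed

lemma score_clt:
  assumes W: "mle_limit_matrix M' W P p"
  shows "converges_in_distribution M score M' W"
proof (rule converges_in_distribution_of_char)
  show "prob_space M" by (rule prob_space_axioms)
  show "prob_space M'" "W \<in> borel_measurable M'"
    using W by (auto simp: mle_limit_matrix_def gaussian_matrix_def)
  show "score n \<in> borel_measurable M" for n by measurable
  show "(\<lambda>n. \<integral>\<omega>. iexp (a \<bullet> score n \<omega>) \<partial>M) \<longlonglongrightarrow> (\<integral>\<omega>. iexp (a \<bullet> W \<omega>) \<partial>M')" for a
    unfolding char_mle_limit_matrix[OF W] score_increment_variance[symmetric] inner_score
    by (rule martingale_clt[OF score_increment_mean])
qed

text \<open>Entrywise the rescaled error is the score times \<open>p $ i / r\<close>, where \<open>r\<close> is the observed frequency of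
state \<open>i\<close>. The tolerance on the frequencies is chosen so that this factor differs from 1 by at
most \<open>\<eta>\<close>; it also forces every state to have been visited.\<close>

lemma mle_close_to_score:
  assumes n: "0 < n" and "0 < \<eta>"
    and freq: "\<And>i. \<bar>real (visit_count X n i \<omega>) / real n - p $ i\<bar> < p $ i * \<eta> / (1 + \<eta>)"
  shows "norm (sqrt (real n) *\<^sub>R (transition_mle X n \<omega> - P) - score n \<omega>) \<le> \<eta> * norm (score n \<omega>)"
proof -
  have entry: "\<bar>(sqrt (real n) *\<^sub>R (transition_mle X n \<omega> - P) - score n \<omega>) $ i $ j\<bar> \<le>
      \<bar>(\<eta> *\<^sub>R score n \<omega>) $ i $ j\<bar>" for i j
  proof -
    define r where "r = real (visit_count X n i \<omega>) / real n"
    let ?N = "real (visit_count X n i \<omega>)"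
    have "p $ i - p $ i * \<eta> / (1 + \<eta>) = p $ i / (1 + \<eta>)"
      using \<open>0 < \<eta>\<close> by (simp add: field_simps)
    moreover have "p $ i - p $ i * \<eta> / (1 + \<eta>) < r"
      using freq[of i] unfolding r_def by linarith
    ultimately have r: "p $ i / (1 + \<eta>) < r" by simp
    moreover have "0 < p $ i / (1 + \<eta>)"
      using p_pos[of i] \<open>0 < \<eta>\<close> by simp
    ultimately have "0 < r" by linarith
    have N: "visit_count X n i \<omega> \<noteq> 0" "?N = r * real n"
    proof
      assume "visit_count X n i \<omega> = 0"
      with \<open>0 < r\<close> show False by (simp add: r_def)
    qed (use n in \<open>simp add: r_def\<close>)
    have "\<bar>p $ i - r\<bar> \<le> \<eta> * (p $ i / (1 + \<eta>))"
      using freq[of i] unfolding r_def by (simp add: mult.commute)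
    also have "\<dots> \<le> \<eta> * r"
      using r \<open>0 < \<eta>\<close> by (intro mult_left_mono) auto
    finally have ratio: "\<bar>p $ i / r - 1\<bar> \<le> \<eta>"
      using \<open>0 < r\<close> by (simp add: field_simps abs_le_iff)
    have sq: "sqrt (real n) * sqrt (real n) = real n" by simp
    have "(sqrt (real n) *\<^sub>R (transition_mle X n \<omega> - P)) $ i $ j = score n \<omega> $ i $ j * (p $ i / r)"
    proof -
      have "sqrt (real n) * (real (transition_count X n i j \<omega>) / ?N - P $ i $ j) =
          sqrt (real n) * (real (transition_count X n i j \<omega>) - P $ i $ j * ?N) / ?N"
        using N(1) by (simp add: field_simps)
      also have "\<dots> = (real (transition_count X n i j \<omega>) - P $ i $ j * ?N) / (sqrt (real n) * r)"
        unfolding N(2) using n \<open>0 < r\<close> sq by (simp add: divide_simps mult_ac)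
      also have "\<dots> = (real (transition_count X n i j \<omega>) - P $ i $ j * ?N) / (sqrt (real n) * p $ i) * (p $ i / r)"
        using p_pos[of i] by simp
      finally show ?thesis
        using N(1) by (simp add: transition_mle_def score_def)
    qed
    then have "(sqrt (real n) *\<^sub>R (transition_mle X n \<omega> - P) - score n \<omega>) $ i $ j =
        score n \<omega> $ i $ j * (p $ i / r - 1)"
      by (simp add: algebra_simps)
    then show ?thesis
      using ratio \<open>0 < \<eta>\<close> by (simp add: abs_mult mult.commute mult_right_mono)
  qed
  have "norm (sqrt (real n) *\<^sub>R (transition_mle X n \<omega> - P) - score n \<omega>) \<le> norm (\<eta> *\<^sub>R score n \<omega>)"
    by (intro norm_le_componentwise_cart) (use entry in \<open>simp only: real_norm_def\<close>)
  then show ?thesis using \<open>0 < \<eta>\<close> by simp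
qed

text \<open>The score is tight and the frequencies converge in probability, so the difference between the
rescaled error and the score is negligible.\<close>

theorem mle_asymptotically_normal:
  assumes W: "mle_limit_matrix M' W P p"
  shows "converges_in_distribution M (\<lambda>n \<omega>. sqrt (real n) *\<^sub>R (transition_mle X n \<omega> - P)) M' W"
proof -
  have M': "prob_space M'"
    using W by (auto simp: mle_limit_matrix_def gaussian_matrix_def)
  have [measurable]: "(\<lambda>\<omega>. transition_mle X n \<omega>) \<in> borel_measurable M" for n
    by (rule measurable_mle)
  have bdd: "bounded_in_probability M score"
    by (rule converges_in_distribution_imp_bounded_in_probability[OF prob_space_axioms M' score_clt[OF W]])
  show ?thesis
  proof (rule converges_in_distribution_Slutsky[OF prob_space_axioms M' score_clt[OF W]])
    let ?D = "\<lambda>n \<omega>. sqrt (real n) *\<^sub>R (transition_mle X n \<omega> - P) - score n \<omega>"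
    fix e :: real assume "0 < e"
    show "(\<lambda>n. prob {\<omega> \<in> space M. e < norm (?D n \<omega>)}) \<longlonglongrightarrow> 0"
    proof (rule tendsto_0_in_probability_if_bounded[OF prob_space_axioms measurable_score _ bdd])
      fix K :: real
      define \<eta> where "\<eta> = e / (\<bar>K\<bar> + 1)"
      have \<eta>: "0 < \<eta>" "\<eta> * \<bar>K\<bar> \<le> e"
        using \<open>0 < e\<close> by (auto simp: \<eta>_def field_simps)
      define \<delta> where "\<delta> i = p $ i * \<eta> / (1 + \<eta>)" for i
      have "0 < \<delta> i" for i
        using p_pos \<eta>(1) by (simp add: \<delta>_def)
      let ?B = "\<lambda>n i. {\<omega> \<in> space M. \<delta> i \<le> \<bar>real (visit_count X n i \<omega>) / real n - p $ i\<bar>}"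
      have [measurable]: "(\<lambda>\<omega>. real (visit_count X n i \<omega>)) \<in> borel_measurable M" for n i
        unfolding real_visit_count by measurable
      have lim: "(\<lambda>n. \<Sum>i\<in>UNIV. prob (?B n i)) \<longlonglongrightarrow> 0"
        using \<open>\<And>i. 0 < \<delta> i\<close> by (intro tendsto_null_sum visit_frequency_converges_in_probability)
      have bound: "prob {\<omega> \<in> space M. norm (score n \<omega>) \<le> K \<and> e < norm (?D n \<omega>)} \<le> (\<Sum>i\<in>UNIV. prob (?B n i))"
        if "0 < n" for n
      proof -
        have "{\<omega> \<in> space M. norm (score n \<omega>) \<le> K \<and> e < norm (?D n \<omega>)} \<subseteq> (\<Union>i\<in>UNIV. ?B n i)"
        proof (rule subsetI, rule ccontr)
          fix \<omega> assume "\<omega> \<in> {\<omega> \<in> space M. norm (score n \<omega>) \<le> K \<and> e < norm (?D n \<omega>)}"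
            and "\<omega> \<notin> (\<Union>i\<in>UNIV. ?B n i)"
          then have K: "norm (score n \<omega>) \<le> K" and e: "e < norm (?D n \<omega>)"
            and freq: "\<And>i. \<bar>real (visit_count X n i \<omega>) / real n - p $ i\<bar> < \<delta> i"
            by (simp_all add: not_le)
          have "norm (?D n \<omega>) \<le> \<eta> * norm (score n \<omega>)"
            using freq by (intro mle_close_to_score[OF that \<eta>(1)]) (simp add: \<delta>_def)
          also have "\<dots> \<le> \<eta> * \<bar>K\<bar>"
            using K \<eta>(1) by (intro mult_left_mono) auto
          finally show False using \<eta>(2) e by linarith
        qed
        then have "prob {\<omega> \<in> space M. norm (score n \<omega>) \<le> K \<and> e < norm (?D n \<omega>)} \<le> prob (\<Union>i\<in>UNIV. ?B n i)"
          by (intro finite_measure_mono) auto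
        also have "\<dots> \<le> (\<Sum>i\<in>UNIV. prob (?B n i))"
          by (intro finite_measure_subadditive_finite) auto
        finally show ?thesis .
      qed
      show "(\<lambda>n. prob {\<omega> \<in> space M. norm (score n \<omega>) \<le> K \<and> e < norm (?D n \<omega>)}) \<longlonglongrightarrow> 0"
      proof (rule tendsto_sandwich[OF _ _ tendsto_const lim])
        show "\<forall>\<^sub>F n in sequentially. prob {\<omega> \<in> space M. norm (score n \<omega>) \<le> K \<and> e < norm (?D n \<omega>)} \<le>
            (\<Sum>i\<in>UNIV. prob (?B n i))"
          using eventually_gt_at_top[of 0] by eventually_elim (rule bound)
      qed simp
    qed measurable
  qed measurable
qed

end

section \<open>Differentiating the matrix inverse\<close>

lemma bounded_bilinear_matrix_mult:
  "bounded_bilinear ((**) :: real^'n^'m \<Rightarrow> real^'p^'n \<Rightarrow> real^'p^'m)"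
proof -
  have matrix_add_rdistrib: "(U + V) ** T = U ** T + V ** T" for U V :: "real^'n^'m" and T :: "real^'p^'n"
    by (simp add: vec_eq_iff matrix_matrix_mult_def distrib_right sum.distrib)
  have "bilinear ((**) :: real^'n^'m \<Rightarrow> real^'p^'n \<Rightarrow> real^'p^'m)"
    unfolding bilinear_def
    by (intro conjI allI linearI)
      (simp_all add: matrix_add_ldistrib matrix_add_rdistrib matrix_scalar_ac flip: scalar_matrix_assoc)
  then show ?thesis
    by (simp add: bilinear_conv_bounded_bilinear)
qed

lemmas matrix_mult_diff_left = bounded_bilinear.diff_left[OF bounded_bilinear_matrix_mult]
  and matrix_mult_diff_right = bounded_bilinear.diff_right[OF bounded_bilinear_matrix_mult]
  and matrix_mult_minus_left = bounded_bilinear.minus_left[OF bounded_bilinear_matrix_mult]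
  and matrix_mult_minus_right = bounded_bilinear.minus_right[OF bounded_bilinear_matrix_mult]

lemma matrix_inv_inverse:
  fixes A :: "real^'n^'n"
  assumes "invertible A"
  shows matrix_inv_right: "A ** matrix_inv A = mat 1"
    and matrix_inv_left: "matrix_inv A ** A = mat 1"
  using assms someI_ex[of "\<lambda>A'. A ** A' = mat 1 \<and> A' ** A = mat 1"]
  unfolding invertible_def matrix_inv_def by auto

lemma open_invertible: "open {A :: real^'n^'n. invertible A}"
proof -
  have "continuous_on UNIV (\<lambda>A :: real^'n^'n. det A)"
    unfolding det_def by (intro continuous_intros)
  then have "open {A :: real^'n^'n. det A \<noteq> 0}"
    by (intro open_Collect_neq continuous_on_const)
  then show ?thesis
    by (simp add: invertible_det_nz)
qed

lemma matrix_inv_diff: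
  fixes A A' :: "real^'n^'n"
  assumes "invertible A" "invertible A'"
  shows "matrix_inv A' - matrix_inv A = - (matrix_inv A' ** (A' - A) ** matrix_inv A)"
proof -
  have "matrix_inv A' ** (A' - A) ** matrix_inv A =
      (matrix_inv A' ** A') ** matrix_inv A - matrix_inv A' ** (A ** matrix_inv A)"
    by (simp add: matrix_mult_diff_left matrix_mult_diff_right matrix_mul_assoc)
  then show ?thesis
    using assms by (simp add: matrix_inv_left matrix_inv_right)
qed

text \<open>Apply the identity $Y - X = -YHX$ for $Y = (A+H)^{-1}$ and $X = A^{-1}$ twice: the remainder is
$YHXHX$. The same identity bounds the norm of $Y$ by twice that of $X$ once $H$ is small.\<close>

theorem has_derivative_matrix_inv:
  fixes A :: "real^'n^'n"
  assumes A: "invertible A"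
  shows "(matrix_inv has_derivative (\<lambda>H. - (matrix_inv A ** H ** matrix_inv A))) (at A)"
  unfolding has_derivative_at_alt
proof (intro conjI allI impI)
  let ?X = "matrix_inv A"
  show "bounded_linear (\<lambda>H. - (?X ** H ** ?X))"
    by (intro bounded_linear_minus
        bounded_linear_compose[OF bounded_bilinear.bounded_linear_left[OF bounded_bilinear_matrix_mult]]
        bounded_bilinear.bounded_linear_right[OF bounded_bilinear_matrix_mult])
  fix e :: real assume "0 < e"
  obtain K where K: "0 < K" "\<And>(U :: real^'n^'n) (V :: real^'n^'n). norm (U ** V) \<le> norm U * norm V * K"
    using bounded_bilinear.pos_bounded[OF bounded_bilinear_matrix_mult] by blast
  have K3: "norm (U ** V ** T) \<le> norm U * norm V * norm T * K\<^sup>2" for U V T :: "real^'n^'n"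
  proof -
    have "norm (U ** V ** T) \<le> norm (U ** V) * norm T * K"
      by (rule K(2))
    also have "\<dots> \<le> (norm U * norm V * K) * norm T * K"
      using K by (intro mult_right_mono) auto
    finally show ?thesis by (simp add: power2_eq_square mult_ac)
  qed
  define x where "x = norm ?X"
  have "0 \<le> x" by (simp add: x_def)
  obtain d0 where d0: "0 < d0" "\<And>A'. norm (A' - A) < d0 \<Longrightarrow> invertible A'"
    using open_invertible A unfolding open_dist by (auto simp: dist_norm)
  \<comment> \<open>The first bound keeps the inverse below \<open>2 * x\<close> in norm, the second makes the quadratic
     remainder smaller than \<open>e * norm H\<close>.\<close>
  define d where "d = min d0 (min (1 / (2 * K\<^sup>2 * x + 1)) (e / (2 * x ^ 3 * (K\<^sup>2)\<^sup>2 + 1)))"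
  have pos: "0 < 2 * K\<^sup>2 * x + 1" "0 < 2 * x ^ 3 * (K\<^sup>2)\<^sup>2 + 1"
    using K(1) \<open>0 \<le> x\<close> by (auto intro!: add_nonneg_pos)
  show "\<exists>d>0. \<forall>A'. norm (A' - A) < d \<longrightarrow>
      norm (matrix_inv A' - ?X - - (?X ** (A' - A) ** ?X)) \<le> e * norm (A' - A)"
  proof (intro exI[of _ d] conjI allI impI)
    show "0 < d"
      using d0(1) pos \<open>0 < e\<close> by (simp add: d_def)
    fix A' assume A': "norm (A' - A) < d"
    define H where "H = A' - A"
    define h where "h = norm H"
    let ?Y = "matrix_inv A'"
    have h: "0 \<le> h" "h < d0" "h < 1 / (2 * K\<^sup>2 * x + 1)" "h < e / (2 * x ^ 3 * (K\<^sup>2)\<^sup>2 + 1)"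
      using A' by (auto simp: d_def h_def H_def)
    have inv: "invertible A'"
      using d0(2) h(2) by (simp add: h_def H_def)
    have diff: "?Y - ?X = - (?Y ** H ** ?X)"
      unfolding H_def by (rule matrix_inv_diff[OF A inv])
    have hx: "2 * (h * x * K\<^sup>2) \<le> 1"
    proof -
      have "h * (2 * K\<^sup>2 * x + 1) < 1"
        using h(3) pos(1) by (simp add: pos_less_divide_eq)
      then show ?thesis using h(1) by (simp add: algebra_simps)
    qed
    have "norm ?Y \<le> norm ?X + norm (?Y - ?X)"
      using norm_triangle_ineq[of ?X "?Y - ?X"] by simp
    also have "norm (?Y - ?X) \<le> norm ?Y * h * x * K\<^sup>2"
      unfolding diff norm_minus_cancel h_def x_def by (rule K3)
    also have "norm ?Y * h * x * K\<^sup>2 \<le> norm ?Y * (1 / 2)"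
      using mult_left_mono[OF hx, of "norm ?Y"] by (simp add: mult_ac)
    finally have Y: "norm ?Y \<le> 2 * x"
      by (simp add: x_def)
    have "?Y - ?X - - (?X ** H ** ?X) = - (?Y ** H ** ?X) - - (?X ** H ** ?X)"
      unfolding diff ..
    also have "\<dots> = - ((?Y - ?X) ** H ** ?X)"
      by (simp add: matrix_mult_diff_left)
    also have "norm \<dots> \<le> norm (?Y - ?X) * h * x * K\<^sup>2"
      unfolding norm_minus_cancel h_def x_def by (rule K3)
    also have "\<dots> \<le> (norm ?Y * h * x * K\<^sup>2) * h * x * K\<^sup>2"
    proof (intro mult_right_mono)
      show "norm (?Y - ?X) \<le> norm ?Y * h * x * K\<^sup>2"
        unfolding diff norm_minus_cancel h_def x_def by (rule K3)
    qed (use h(1) \<open>0 \<le> x\<close> in auto)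
    also have "\<dots> \<le> (2 * x * h * x * K\<^sup>2) * h * x * K\<^sup>2"
      using Y h(1) \<open>0 \<le> x\<close> by (intro mult_right_mono) auto
    also have "\<dots> = (h * (2 * x ^ 3 * (K\<^sup>2)\<^sup>2)) * h"
      by (simp add: power2_eq_square power3_eq_cube mult_ac)
    also have "\<dots> \<le> e * h"
    proof (rule mult_right_mono)
      have "h * (2 * x ^ 3 * (K\<^sup>2)\<^sup>2 + 1) < e"
        using h(4) pos(2) by (simp add: pos_less_divide_eq)
      then show "h * (2 * x ^ 3 * (K\<^sup>2)\<^sup>2) \<le> e"
        using h(1) by (simp add: distrib_left)
    qed (rule h(1))
    finally show "norm (?Y - ?X - - (?X ** (A' - A) ** ?X)) \<le> e * norm (A' - A)"
      by (simp only: H_def h_def)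
  qed
qed

lemma has_derivative_resolvent:
  fixes P :: "real^'s^'s" and B :: "real^'s^'r" and C :: "real^'r^'s" and N :: "real^'s^'s \<Rightarrow> real^'r^'r"
  assumes inv: "invertible (mat 1 - B ** P ** C)"
    and N: "\<And>Q. invertible (mat 1 - B ** Q ** C) \<Longrightarrow> N Q = matrix_inv (mat 1 - B ** Q ** C)"
  shows "(N has_derivative (\<lambda>H. N P ** B ** H ** C ** N P)) (at P)"
proof -
  have lin: "bounded_linear (\<lambda>Q. B ** Q ** C)"
    by (intro bounded_linear_compose[OF bounded_bilinear.bounded_linear_left[OF bounded_bilinear_matrix_mult]]
        bounded_bilinear.bounded_linear_right[OF bounded_bilinear_matrix_mult])
  let ?F = "\<lambda>Q. mat 1 - B ** Q ** C"
  have F: "(?F has_derivative (\<lambda>H. - (B ** H ** C))) (at P)"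
    using has_derivative_diff[OF has_derivative_const bounded_linear_imp_has_derivative[OF lin]] by simp
  have "((\<lambda>Q. matrix_inv (?F Q)) has_derivative
      (\<lambda>H. - (matrix_inv (?F P) ** (- (B ** H ** C)) ** matrix_inv (?F P)))) (at P)"
    by (rule has_derivative_compose[OF F has_derivative_matrix_inv[OF inv]])
  then have deriv: "((\<lambda>Q. matrix_inv (?F Q)) has_derivative (\<lambda>H. N P ** B ** H ** C ** N P)) (at P)"
    by (simp add: N[OF inv] matrix_mult_minus_left matrix_mult_minus_right matrix_mul_assoc)
  have "continuous_on UNIV ?F"
    by (intro continuous_on_diff continuous_on_const linear_continuous_on lin)
  then have "open (?F -` {A. invertible A})"
    by (rule open_vimage[OF open_invertible])
  then show ?thesis
    by (rule has_derivative_transform_within_open[OF deriv]) (use inv N in auto)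
qed

text \<open>Compare the two sides of the eigenvalue equation at an entry of the eigenvector of largest modulus.
A bound is needed for the supremum in \<^const>\<open>spectral_radius\<close> to dominate the eigenvalues.\<close>

lemma bounded_complex_spectrum:
  fixes A :: "real^'r^'r"
  assumes "l \<in> complex_spectrum A"
  shows "cmod l \<le> (\<Sum>i\<in>UNIV. \<Sum>j\<in>UNIV. \<bar>A $ i $ j\<bar>)"
proof -
  obtain v where v: "v \<noteq> 0" "map_matrix of_real A *v v = l *s v"
    using assms by (auto simp: complex_spectrum_def)
  obtain i where i: "\<And>j. cmod (v $ j) \<le> cmod (v $ i)"
  proof -
    have "Max (range (\<lambda>j. cmod (v $ j))) \<in> range (\<lambda>j. cmod (v $ j))"
      by (rule Max_in) auto
    then obtain i where "Max (range (\<lambda>j. cmod (v $ j))) = cmod (v $ i)" by blast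
    then have "cmod (v $ j) \<le> cmod (v $ i)" for j
      using Max_ge[of "range (\<lambda>j. cmod (v $ j))" "cmod (v $ j)"] by simp
    then show ?thesis using that by blast
  qed
  have pos: "0 < cmod (v $ i)"
  proof (rule ccontr)
    assume "\<not> 0 < cmod (v $ i)"
    then have "v $ j = 0" for j
      using i[of j] by simp
    then show False using v(1) by (simp add: vec_eq_iff)
  qed
  have "l * v $ i = (\<Sum>j\<in>UNIV. of_real (A $ i $ j) * v $ j)"
    using arg_cong[OF v(2), of "\<lambda>w. w $ i"] by (simp add: matrix_vector_mult_def)
  then have "cmod l * cmod (v $ i) \<le> (\<Sum>j\<in>UNIV. cmod (of_real (A $ i $ j) * v $ j))"
    by (metis norm_mult norm_sum)
  also have "\<dots> \<le> (\<Sum>j\<in>UNIV. \<bar>A $ i $ j\<bar> * cmod (v $ i))"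
    using i by (intro sum_mono) (simp add: norm_mult mult_left_mono)
  also have "\<dots> = (\<Sum>j\<in>UNIV. \<bar>A $ i $ j\<bar>) * cmod (v $ i)"
    by (simp add: sum_distrib_right)
  finally have "cmod l \<le> (\<Sum>j\<in>UNIV. \<bar>A $ i $ j\<bar>)"
    using pos by simp
  also have "\<dots> \<le> (\<Sum>i\<in>UNIV. \<Sum>j\<in>UNIV. \<bar>A $ i $ j\<bar>)"
    by (rule member_le_sum[of i UNIV "\<lambda>i. \<Sum>j\<in>UNIV. \<bar>A $ i $ j\<bar>"]) (auto intro: sum_nonneg)
  finally show ?thesis .
qed

text \<open>Otherwise 1 is an eigenvalue: a kernel vector of \<open>mat 1 - A\<close>, read as a complex vector, is fixed by \<open>A\<close>.\<close>

lemma invertible_if_spectral_radius_less_1: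
  fixes A :: "real^'r^'r"
  assumes "spectral_radius A < 1"
  shows "invertible (mat 1 - A)"
proof (rule ccontr)
  assume "\<not> ?thesis"
  then obtain x where x: "x \<noteq> 0" "(mat 1 - A) *v x = 0"
    by (auto simp: invertible_left_inverse matrix_left_invertible_ker)
  then have Ax: "A *v x = x"
    by (simp add: matrix_vector_mult_diff_rdistrib)
  define v :: "complex^'r" where "v = (\<chi> i. of_real (x $ i))"
  have "v \<noteq> 0"
    using x(1) by (auto simp: v_def vec_eq_iff)
  moreover have "map_matrix of_real A *v v = 1 *s v"
  proof -
    have "(map_matrix of_real A *v v) $ i = of_real ((A *v x) $ i)" for i
      by (simp add: v_def matrix_vector_mult_def)
    then show ?thesis
      by (simp add: Ax vec_eq_iff) (simp add: v_def)
  qed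
  ultimately have "1 \<in> complex_spectrum A"
    unfolding complex_spectrum_def by blast
  moreover have "bdd_above (cmod ` complex_spectrum A)"
    by (rule bdd_aboveI2[OF bounded_complex_spectrum])
  ultimately have "cmod 1 \<le> spectral_radius A"
    unfolding spectral_radius_def by (rule cSUP_upper)
  with assms show False by simp
qed

section \<open>The fundamental matrix of the estimated chain\<close>

theorem proposition6:
  fixes P :: "real^'s^'s" and p :: "real^'s"
    and B :: "real^'s^'r" and C :: "real^'r^'s"
    and N :: "real^'s^'s \<Rightarrow> real^'r^'r"
    and u v :: "real^'r" and \<phi> :: "real^'s^'s \<Rightarrow> real"
    and M :: "'a measure" and X :: "nat \<Rightarrow> 'a \<Rightarrow> 's"
    and M' :: "'b measure" and W :: "'b \<Rightarrow> real^'s^'s"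
  assumes "stochastic_matrix P" and "irreducible_matrix P" and "stationary_vector P p"
    and "markov_chain M X P"
    and "mle_limit_matrix M' W P p"
    and "spectral_radius (B ** P ** C) < 1"
    \<comment> \<open>\<open>N\<close> and \<open>\<phi>\<close> are arbitrary where the inverse does not exist.\<close>
    and "\<And>Q. invertible (mat 1 - B ** Q ** C) \<Longrightarrow> N Q = matrix_inv (mat 1 - B ** Q ** C)"
    and "\<And>Q. invertible (mat 1 - B ** Q ** C) \<Longrightarrow> \<phi> Q = u \<bullet> (N Q *v v)"
  shows "(N has_derivative (\<lambda>H. N P ** B ** H ** C ** N P)) (at P)
    \<and> converges_in_distribution
        M (\<lambda>n \<omega>. sqrt (real n) *\<^sub>R (N (transition_mle X n \<omega>) - N P))
        M' (\<lambda>\<omega>. N P ** B ** W \<omega> ** C ** N P)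
    \<and> converges_in_distribution
        M (\<lambda>n \<omega>. sqrt (real n) * (\<phi> (transition_mle X n \<omega>) - \<phi> P))
        M' (\<lambda>\<omega>. u \<bullet> ((N P ** B ** W \<omega> ** C ** N P) *v v))"
proof -
  interpret irreducible_markov_chain M X P p
    using assms(1-4) by unfold_locales
  have M': "prob_space M'"
    using assms(5) by (auto simp: mle_limit_matrix_def gaussian_matrix_def)
  note clt = mle_asymptotically_normal[OF assms(5)]
  have inv: "invertible (mat 1 - B ** P ** C)"
    by (rule invertible_if_spectral_radius_less_1[OF assms(6)])
  have N: "(N has_derivative (\<lambda>H. N P ** B ** H ** C ** N P)) (at P)"
    by (rule has_derivative_resolvent[OF inv assms(7)])
  let ?U = "{Q. invertible (mat 1 - B ** Q ** C)}"
  have "continuous_on UNIV (\<lambda>Q. mat 1 - B ** Q ** C)"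
    by (intro continuous_on_diff continuous_on_const linear_continuous_on
        bounded_linear_compose[OF bounded_bilinear.bounded_linear_left[OF bounded_bilinear_matrix_mult]]
        bounded_bilinear.bounded_linear_right[OF bounded_bilinear_matrix_mult])
  then have "open ?U"
    using open_vimage[OF open_invertible] by (simp add: vimage_def)
  have "bounded_linear (\<lambda>A :: real^'r^'r. u \<bullet> (A *v v))"
    by (intro linear_conv_bounded_linear[THEN iffD1] linearI)
      (simp_all add: matrix_vector_mult_add_rdistrib inner_add_right scaleR_matrix_vector_assoc[symmetric])
  then have "((\<lambda>Q. u \<bullet> (N Q *v v)) has_derivative
      (\<lambda>H. u \<bullet> ((N P ** B ** H ** C ** N P) *v v))) (at P)"
    by (rule bounded_linear.has_derivative[OF _ N])
  then have \<phi>: "(\<phi> has_derivative (\<lambda>H. u \<bullet> ((N P ** B ** H ** C ** N P) *v v))) (at P)"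
    by (rule has_derivative_transform_within_open[OF _ \<open>open ?U\<close>]) (use inv assms(8) in auto)
  have "converges_in_distribution
      M (\<lambda>n \<omega>. sqrt (real n) *\<^sub>R (\<phi> (transition_mle X n \<omega>) - \<phi> P))
      M' (\<lambda>\<omega>. u \<bullet> ((N P ** B ** W \<omega> ** C ** N P) *v v))"
    by (rule delta_method[OF prob_space_axioms M' clt \<phi> measurable_mle])
  with N delta_method[OF prob_space_axioms M' clt N measurable_mle] show ?thesis
    by simp
qed

end
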